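(* Let $D$ be a syntactical data type (a type that is both an input type and an output type) of system $\mathcal F$ in which the type constant $\perp$ does not occur. If $T$ is a closed $\lambda$-term with $\vdash_{\mathcal F} T : D^*\rightarrow\neg\neg D$, then $T$ is a storage operator for $D$: for every $\lambda$-term $t$ with $\vdash_{\mathcal F} t : D$ there exist $\lambda$-terms $\tau,\tau'$ with $\tau\simeq_\beta\tau'$ and $\vdash_{\mathcal F}\tau' : D$ such that for every $\lambda$-term $\theta_t\simeq_\beta t$ there is a substitution $\sigma$ with $(T)\theta_t f\succ_f (f)\sigma(\tau)$, where $f$ is a fresh variable.
   Context: $\lambda$-terms are those of the untyped $\lambda$-calculus; $\simeq_\beta$ is $\beta$-equivalence; $Fv(t)$ the free variables; normal means without $\beta$-redex. $u\succ_f v$ means $v$ is obtained from $u$ by weak head reduction (repeatedly reducing the redex $(\lambda x u)v$ in a term $(\lambda x u)v v_1\dots v_m$). Types of system $\mathcal F$ are built from type variables and type constants (atomic, not quantifiable; in particular distinct constants $O$ and $\perp$) with $\rightarrow$, $\forall$; only proper types (in every $\forall XA$, $X$ occurs free in $A$). Typing: (ax) $\Gamma \vdash x_i : A_i$ for $x_i:A_i\in\Gamma$; ($\rightarrow_i$) from $\Gamma, x:B \vdash t : C$ infer $\Gamma \vdash \lambda x t : B \rightarrow C$; ($\rightarrow_e$) from $\Gamma \vdash u : B\rightarrow C$, $\Gamma \vdash v : B$ infer $\Gamma \vdash (u)v : C$; ($\forall_i$) from $\Gamma \vdash t : A$, $X$ not free in $\Gamma$, infer $\Gamma \vdash t : \forall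 X A$; ($\forall_e$) from $\Gamma \vdash t : \forall X A$ infer $\Gamma \vdash t : A[C/X]$. $\mathcal F_0$ is $\mathcal F$ without ($\forall_e$). An input type is a closed type $E$ such that for every normal $t$, $\vdash_{\mathcal F} t:E$ implies $\vdash_{\mathcal F_0} t:E$. An output type is a closed type $S$ not containing $O$ such that for every normal $t$ and variable $\alpha$, $\alpha:O\vdash_{\mathcal F}t:S$ implies $\alpha\notin Fv(t)$. $\neg A$ denotes $A\rightarrow\perp$; $A^*$ is obtained from $A$ by replacing each atomic subformula $R$ by $\neg R$. *)

theory Defs
  imports Main
begin

datatype tm = Var nat | App tm tm | Lam tm

definition upr :: "(nat \<Rightarrow> nat) \<Rightarrow> nat \<Rightarrow> nat" where
  "upr r = (\<lambda>n. case n of 0 \<Rightarrow> 0 | Suc m \<Rightarrow> Suc (r m))"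

fun ren :: "(nat \<Rightarrow> nat) \<Rightarrow> tm \<Rightarrow> tm" where
  "ren r (Var n) = Var (r n)"
| "ren r (App s t) = App (ren r s) (ren r t)"
| "ren r (Lam t) = Lam (ren (upr r) t)"

definition ups :: "(nat \<Rightarrow> tm) \<Rightarrow> nat \<Rightarrow> tm" where
  "ups \<sigma> = (\<lambda>n. case n of 0 \<Rightarrow> Var 0 | Suc m \<Rightarrow> ren Suc (\<sigma> m))"

fun sub :: "(nat \<Rightarrow> tm) \<Rightarrow> tm \<Rightarrow> tm" where
  "sub \<sigma> (Var n) = \<sigma> n"
| "sub \<sigma> (App s t) = App (sub \<sigma> s) (sub \<sigma> t)"
| "sub \<sigma> (Lam t) = Lam (sub (ups \<sigma>) t)"

definition inst :: "tm \<Rightarrow> nat \<Rightarrow> tm" where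
  "inst u = (\<lambda>n. case n of 0 \<Rightarrow> u | Suc m \<Rightarrow> Var m)"

fun fv :: "tm \<Rightarrow> nat set" where
  "fv (Var n) = {n}"
| "fv (App s t) = fv s \<union> fv t"
| "fv (Lam t) = (\<lambda>n. n - 1) ` (fv t - {0})"

inductive beta :: "tm \<Rightarrow> tm \<Rightarrow> bool" where
  redex: "beta (App (Lam s) t) (sub (inst t) s)"
| appL: "beta s s' \<Longrightarrow> beta (App s t) (App s' t)"
| appR: "beta t t' \<Longrightarrow> beta (App s t) (App s t')"
| lam: "beta t t' \<Longrightarrow> beta (Lam t) (Lam t')"

definition beta_eq :: "tm \<Rightarrow> tm \<Rightarrow> bool" where
  "beta_eq = equivclp beta"

fun normal :: "tm \<Rightarrow> bool" where
  "normal (Var n) = True"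
| "normal (Lam t) = normal t"
| "normal (App s t) = ((\<forall>u. s \<noteq> Lam u) \<and> normal s \<and> normal t)"

inductive whr1 :: "tm \<Rightarrow> tm \<Rightarrow> bool" where
  head: "whr1 (App (Lam s) t) (sub (inst t) s)"
| app: "whr1 s s' \<Longrightarrow> whr1 (App s t) (App s' t)"

definition whr :: "tm \<Rightarrow> tm \<Rightarrow> bool" where
  "whr = whr1\<^sup>*\<^sup>*"

datatype ty = TV nat | TO | TBot | TC nat | Arr ty ty | Forall ty

fun tren :: "(nat \<Rightarrow> nat) \<Rightarrow> ty \<Rightarrow> ty" where
  "tren r (TV n) = TV (r n)"
| "tren r TO = TO"
| "tren r TBot = TBot"
| "tren r (TC c) = TC c"
| "tren r (Arr A B) = Arr (tren r A) (tren r B)"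
| "tren r (Forall A) = Forall (tren (upr r) A)"

definition tups :: "(nat \<Rightarrow> ty) \<Rightarrow> nat \<Rightarrow> ty" where
  "tups s = (\<lambda>n. case n of 0 \<Rightarrow> TV 0 | Suc m \<Rightarrow> tren Suc (s m))"

fun tsub :: "(nat \<Rightarrow> ty) \<Rightarrow> ty \<Rightarrow> ty" where
  "tsub s (TV n) = s n"
| "tsub s TO = TO"
| "tsub s TBot = TBot"
| "tsub s (TC c) = TC c"
| "tsub s (Arr A B) = Arr (tsub s A) (tsub s B)"
| "tsub s (Forall A) = Forall (tsub (tups s) A)"

definition tinst :: "ty \<Rightarrow> nat \<Rightarrow> ty" where
  "tinst C = (\<lambda>n. case n of 0 \<Rightarrow> C | Suc m \<Rightarrow> TV m)"

fun ftv :: "ty \<Rightarrow> nat set" where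
  "ftv (TV n) = {n}"
| "ftv TO = {}"
| "ftv TBot = {}"
| "ftv (TC c) = {}"
| "ftv (Arr A B) = ftv A \<union> ftv B"
| "ftv (Forall A) = (\<lambda>n. n - 1) ` (ftv A - {0})"

definition closed_ty :: "ty \<Rightarrow> bool" where
  "closed_ty A \<longleftrightarrow> ftv A = {}"

fun proper :: "ty \<Rightarrow> bool" where
  "proper (TV n) = True"
| "proper TO = True"
| "proper TBot = True"
| "proper (TC c) = True"
| "proper (Arr A B) = (proper A \<and> proper B)"
| "proper (Forall A) = (0 \<in> ftv A \<and> proper A)"

fun has_O :: "ty \<Rightarrow> bool" where
  "has_O (TV n) = False"
| "has_O TO = True"
| "has_O TBot = False"
| "has_O (TC c) = False"
| "has_O (Arr A B) = (has_O A \<or> has_O B)"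
| "has_O (Forall A) = has_O A"

fun has_Bot :: "ty \<Rightarrow> bool" where
  "has_Bot (TV n) = False"
| "has_Bot TO = False"
| "has_Bot TBot = True"
| "has_Bot (TC c) = False"
| "has_Bot (Arr A B) = (has_Bot A \<or> has_Bot B)"
| "has_Bot (Forall A) = has_Bot A"

definition neg :: "ty \<Rightarrow> ty" where
  "neg A = Arr A TBot"

fun star :: "ty \<Rightarrow> ty" where
  "star (TV n) = neg (TV n)"
| "star TO = neg TO"
| "star TBot = neg TBot"
| "star (TC c) = neg (TC c)"
| "star (Arr A B) = Arr (star A) (star B)"
| "star (Forall A) = Forall (star A)"

text \<open>typing e \<Gamma> t A: the context \<Gamma> types the de Bruijn variable i by \<Gamma>!i.
  If e = True this is system F; if e = False the rule (\<forall>e) is unavailable,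
  i.e. this is system F0.  Only proper types are used: the introduced
  hypothesis type, the instantiating type and the generalised type are proper.
  The rule (\<forall>i) with "X not free in \<Gamma>" is the de Bruijn version: the context is
  shifted.\<close>
inductive typing :: "bool \<Rightarrow> ty list \<Rightarrow> tm \<Rightarrow> ty \<Rightarrow> bool" where
  ax: "i < length \<Gamma> \<Longrightarrow> typing e \<Gamma> (Var i) (\<Gamma> ! i)"
| arr_i: "proper B \<Longrightarrow> typing e (B # \<Gamma>) t C \<Longrightarrow> typing e \<Gamma> (Lam t) (Arr B C)"
| arr_e: "typing e \<Gamma> u (Arr B C) \<Longrightarrow> typing e \<Gamma> v B \<Longrightarrow> typing e \<Gamma> (App u v) C"
| all_i: "typing e (map (tren Suc) \<Gamma>) t A \<Longrightarrow> 0 \<in> ftv A \<Longrightarrow> typing e \<Gamma> t (Forall A)"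
| all_e: "e \<Longrightarrow> typing e \<Gamma> t (Forall A) \<Longrightarrow> proper C \<Longrightarrow> typing e \<Gamma> t (tsub (tinst C) A)"

abbreviation typF :: "ty list \<Rightarrow> tm \<Rightarrow> ty \<Rightarrow> bool" where
  "typF \<equiv> typing True"

abbreviation typF0 :: "ty list \<Rightarrow> tm \<Rightarrow> ty \<Rightarrow> bool" where
  "typF0 \<equiv> typing False"

definition input_type :: "ty \<Rightarrow> bool" where
  "input_type E \<longleftrightarrow> closed_ty E \<and> proper E \<and>
     (\<forall>t. normal t \<longrightarrow> typF [] t E \<longrightarrow> typF0 [] t E)"

text \<open>Output type: the context \<alpha>:O is the one-element context [O]; \<alpha> is variable 0.\<close>
definition output_type :: "ty \<Rightarrow> bool" where
  "output_type S \<longleftrightarrow> closed_ty S \<and> proper S \<and> \<not> has_O S \<and>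
     (\<forall>t. normal t \<longrightarrow> typF [TO] t S \<longrightarrow> 0 \<notin> fv t)"

definition syntactical_data_type :: "ty \<Rightarrow> bool" where
  "syntactical_data_type D \<longleftrightarrow> input_type D \<and> output_type D"

end

theory Submission
  imports Defs "HOL-Library.Confluence"
begin

text \<open>Let n be the normal form of t. It is typable in F0, and since F0 has no instantiation rule, a
  derivation of n : D is also a derivation of n : D*. Reduce T x f, where the variable x stands for an
  arbitrary term equivalent to n. Whenever such a variable reaches the head position, the subterm u
  of n that it stands for is decomposed one constructor at a time, and each argument occurring in u
  becomes a new variable, standing for a closure (v, e) of a subterm v of n. By standardization,
  every term equivalent to n simulates this run up to the substitution of the variables, and the
  typing of u in F0 guarantees that the head always receives enough arguments. Taking n itself for x, the run
  terminates because T n f is typable, hence it reaches f applied to some \<tau> : D.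

  All types A* of closure variables and the type of f have, after replacing \<bottom> by O, an inhabitant
  \<lambda>x1...xk. \<alpha> with \<alpha> : O. Substituting these in \<tau> and normalizing gives a term of type D, which by the output
  property does not contain \<alpha>. So the normal form of \<tau> has no free variables and has type D.\<close>

subsection \<open>Substitution\<close>

lemma mem_fv_Lam [simp]: "i \<in> fv (Lam t) \<longleftrightarrow> Suc i \<in> fv t"
proof
  assume "Suc i \<in> fv t"
  then have "Suc i - 1 \<in> (\<lambda>n. n - 1) ` (fv t - {0})" by (intro imageI) simp
  then show "i \<in> fv (Lam t)" by simp
next
  assume "i \<in> fv (Lam t)"
  then obtain k where "i = k - 1" "k \<in> fv t" "k \<noteq> 0" by auto
  then show "Suc i \<in> fv t" by (cases k) auto
qed

declare fv.simps(3) [simp del]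

lemma upr_simps [simp]: "upr r 0 = 0" "upr r (Suc n) = Suc (r n)"
  by (simp_all add: upr_def)

lemma ups_simps [simp]: "ups \<sigma> 0 = Var 0" "ups \<sigma> (Suc n) = ren Suc (\<sigma> n)"
  by (simp_all add: ups_def)

lemma inst_simps [simp]: "inst u 0 = u" "inst u (Suc n) = Var n"
  by (simp_all add: inst_def)

lemma sub_cong_fv: "(\<And>i. i \<in> fv t \<Longrightarrow> \<sigma> i = \<tau> i) \<Longrightarrow> sub \<sigma> t = sub \<tau> t"
proof (induction t arbitrary: \<sigma> \<tau>)
  case (App s t)
  have "sub \<sigma> s = sub \<tau> s" "sub \<sigma> t = sub \<tau> t"
    by (rule App.IH, rule App.prems, simp)+
  then show ?case by simp
next
  case (Lam t)
  have "sub (ups \<sigma>) t = sub (ups \<tau>) t"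
  proof (rule Lam.IH)
    fix i assume "i \<in> fv t"
    then show "ups \<sigma> i = ups \<tau> i" using Lam.prems[of "i - 1"] by (cases i) simp_all
  qed
  then show ?case by simp
qed simp

lemma ren_eq_sub: "ren r t = sub (\<lambda>n. Var (r n)) t"
proof (induction t arbitrary: r)
  case (Lam t)
  have "ups (\<lambda>n. Var (r n)) = (\<lambda>n. Var (upr r n))"
    by (rule ext) (simp add: ups_def upr_def split: nat.split)
  with Lam show ?case by simp
qed auto

lemma sub_Var [simp]: "sub Var t = t"
proof (induction t)
  case (Lam t)
  have "ups Var = Var" by (rule ext) (simp add: ups_def split: nat.split)
  with Lam show ?case by simp
qed auto

lemma sub_ren: "sub \<sigma> (ren r t) = sub (\<lambda>n. \<sigma> (r n)) t"
proof (induction t arbitrary: \<sigma> r)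
  case (Lam t)
  have "(\<lambda>n. ups \<sigma> (upr r n)) = ups (\<lambda>n. \<sigma> (r n))"
    by (rule ext) (simp add: ups_def upr_def split: nat.split)
  with Lam show ?case by simp
qed auto

lemma ren_ren: "ren r (ren r' t) = ren (\<lambda>n. r (r' n)) t"
  by (simp add: ren_eq_sub[of r] sub_ren) (simp add: ren_eq_sub)

lemma ren_sub: "ren r (sub \<sigma> t) = sub (\<lambda>n. ren r (\<sigma> n)) t"
proof (induction t arbitrary: \<sigma> r)
  case (Lam t)
  have "(\<lambda>n. ren (upr r) (ups \<sigma> n)) = ups (\<lambda>n. ren r (\<sigma> n))"
    by (rule ext) (simp add: ups_def ren_ren split: nat.split)
  with Lam show ?case by simp
qed auto

lemma sub_sub: "sub \<sigma> (sub \<tau> t) = sub (\<lambda>n. sub \<sigma> (\<tau> n)) t"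
proof (induction t arbitrary: \<sigma> \<tau>)
  case (Lam t)
  have "(\<lambda>n. sub (ups \<sigma>) (ups \<tau> n)) = ups (\<lambda>n. sub \<sigma> (\<tau> n))"
    by (rule ext) (simp add: ups_def sub_ren ren_sub split: nat.split)
  with Lam show ?case by simp
qed auto

text \<open>Contracting a redex whose body carries a substitution amounts to evaluating the body in
  the extended environment. This form of the head step serves both the reducibility argument and the
  runs of closures.\<close>

lemma sub_inst_ups: "sub (inst u) (sub (ups \<sigma>) t) = sub (case_nat u \<sigma>) t"
proof -
  have "(\<lambda>n. sub (inst u) (ups \<sigma> n)) = case_nat u \<sigma>"
    by (rule ext) (simp add: sub_ren split: nat.split)
  then show ?thesis by (simp add: sub_sub)
qed

lemma sub_sub_inst: "sub \<sigma> (sub (inst u) t) = sub (inst (sub \<sigma> u)) (sub (ups \<sigma>) t)"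
proof -
  have "(\<lambda>n. sub \<sigma> (inst u n)) = case_nat (sub \<sigma> u) \<sigma>"
    by (rule ext) (simp add: inst_def split: nat.split)
  then show ?thesis by (simp add: sub_inst_ups sub_sub[of \<sigma> "inst u"])
qed

lemma ups_Var: "ups (\<lambda>n. Var (r n)) = (\<lambda>n. Var (upr r n))"
  by (rule ext) (simp add: ups_def upr_def split: nat.split)

lemma ren_sub_inst: "ren r (sub (inst u) t) = sub (inst (ren r u)) (ren (upr r) t)"
  using sub_sub_inst[of "\<lambda>n. Var (r n)" u t] by (simp add: ren_eq_sub ups_Var)

lemma sub_closed: "fv t = {} \<Longrightarrow> sub \<sigma> t = t"
  using sub_cong_fv[of t \<sigma> Var] by simp

subsection \<open>Confluence\<close>

text \<open>Parallel reduction of Tait and Martin-Loef: any set of redexes already present is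
  contracted in one step.\<close>

inductive par :: "tm \<Rightarrow> tm \<Rightarrow> bool" where
  var: "par (Var n) (Var n)"
| app: "par s s' \<Longrightarrow> par t t' \<Longrightarrow> par (App s t) (App s' t')"
| lam: "par t t' \<Longrightarrow> par (Lam t) (Lam t')"
| redex: "par s s' \<Longrightarrow> par t t' \<Longrightarrow> par (App (Lam s) t) (sub (inst t') s')"

inductive_cases par_LamE: "par (Lam s) u"
lemma par_refl: "par t t"
  by (induction t) (auto intro: par.intros)

lemma par_ren: "par t t' \<Longrightarrow> par (ren r t) (ren r t')"
  by (induction t t' arbitrary: r rule: par.induct)
    (auto intro: par.intros simp: ren_sub_inst)

lemma par_ups: "(\<And>i. par (\<sigma> i) (\<sigma>' i)) \<Longrightarrow> par (ups \<sigma> i) (ups \<sigma>' i)"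
  by (cases i) (auto intro: par_refl par_ren)

lemma par_sub: "par t t' \<Longrightarrow> (\<And>i. par (\<sigma> i) (\<sigma>' i)) \<Longrightarrow> par (sub \<sigma> t) (sub \<sigma>' t')"
proof (induction t t' arbitrary: \<sigma> \<sigma>' rule: par.induct)
  case (lam t t')
  from lam.IH[OF par_ups[OF lam.prems]] show ?case by (simp add: par.lam)
next
  case (redex s s' t t')
  from par.redex[OF redex.IH(1)[OF par_ups[OF redex.prems]] redex.IH(2)[OF redex.prems]]
  show ?case by (simp add: sub_sub_inst)
qed (simp_all add: par.app)

lemma par_inst: "par s s' \<Longrightarrow> par t t' \<Longrightarrow> par (sub (inst t) s) (sub (inst t') s')"
  by (rule par_sub) (auto simp: inst_def intro: par_refl split: nat.split)

text \<open>Takahashi's complete development, which contracts all redexes of a term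
  simultaneously.\<close>

fun cd :: "tm \<Rightarrow> tm" where
  "cd (Var n) = Var n"
| "cd (Lam t) = Lam (cd t)"
| "cd (App (Lam s) t) = sub (inst (cd t)) (cd s)"
| "cd (App s t) = App (cd s) (cd t)"

text \<open>Triangle property: the common target depends on \<open>t\<close> alone, so any two
  parallel reducts of \<open>t\<close> meet there in one step.\<close>

lemma par_cd: "par t u \<Longrightarrow> par u (cd t)"
proof (induction t u rule: par.induct)
  case (app s s' t t')
  show ?case
  proof (cases s)
    case (Lam s1)
    with app obtain s2 where "s' = Lam s2" "par s2 (cd s1)"
      by (auto elim!: par_LamE)
    with app Lam show ?thesis by (auto intro: par.intros)
  qed (use app in \<open>auto intro: par.intros\<close>)
qed (auto intro: par.intros par_inst)

lemma beta_par: "beta t u \<Longrightarrow> par t u"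
  by (induction t u rule: beta.induct) (auto intro: par.intros par_refl)

lemma betas_appL: "beta\<^sup>*\<^sup>* s s' \<Longrightarrow> beta\<^sup>*\<^sup>* (App s t) (App s' t)"
  by (induction rule: rtranclp_induct) (rule rtranclp.rtrancl_refl, erule rtranclp.rtrancl_into_rtrancl, erule beta.appL)

lemma betas_appR: "beta\<^sup>*\<^sup>* t t' \<Longrightarrow> beta\<^sup>*\<^sup>* (App s t) (App s t')"
  by (induction rule: rtranclp_induct) (rule rtranclp.rtrancl_refl, erule rtranclp.rtrancl_into_rtrancl, erule beta.appR)

lemma betas_app: "beta\<^sup>*\<^sup>* s s' \<Longrightarrow> beta\<^sup>*\<^sup>* t t' \<Longrightarrow> beta\<^sup>*\<^sup>* (App s t) (App s' t')"
  by (rule rtranclp_trans[OF betas_appL betas_appR])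

lemma betas_lam: "beta\<^sup>*\<^sup>* t t' \<Longrightarrow> beta\<^sup>*\<^sup>* (Lam t) (Lam t')"
  by (induction rule: rtranclp_induct) (rule rtranclp.rtrancl_refl, erule rtranclp.rtrancl_into_rtrancl, erule beta.lam)

lemma par_betas: "par t u \<Longrightarrow> beta\<^sup>*\<^sup>* t u"
proof (induction t u rule: par.induct)
  case (redex s s' t t')
  from betas_app[OF betas_lam[OF redex.IH(1)] redex.IH(2)]
  have "beta\<^sup>*\<^sup>* (App (Lam s) t) (App (Lam s') t')" .
  then show ?case by (rule rtranclp.rtrancl_into_rtrancl) (rule beta.redex)
qed (simp_all add: betas_app betas_lam)

lemma par_rtranclp: "par\<^sup>*\<^sup>* = beta\<^sup>*\<^sup>*"
proof (rule antisym)
  show "par\<^sup>*\<^sup>* \<le> beta\<^sup>*\<^sup>*"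
    using rtranclp_mono[of par "beta\<^sup>*\<^sup>*"] par_betas by (simp add: le_fun_def)
  show "beta\<^sup>*\<^sup>* \<le> par\<^sup>*\<^sup>*" by (rule rtranclp_mono) (auto intro: beta_par)
qed

text \<open>\<open>par\<close> lies between \<open>beta\<close> and its reflexive transitive
  closure, so both relations have the same closure, and the triangle property makes
  \<open>par\<close> strongly confluent.\<close>

lemma confluentp_beta: "confluentp beta"
proof -
  have "strong_confluentp par"
    by (rule strong_confluentpI) (meson par_cd r_into_rtranclp sup2I1)
  then have "confluentp par" by (rule strong_confluentp_imp_confluentp)
  then show ?thesis by (simp add: confluentp_def par_rtranclp rtranclp_conversep)
qed

lemma normal_no_beta: "beta t u \<Longrightarrow> \<not> normal t"
  by (induction rule: beta.induct) auto

lemma normal_betas: "beta\<^sup>*\<^sup>* t u \<Longrightarrow> normal t \<Longrightarrow> u = t"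
  by (induction rule: rtranclp_induct) (auto dest: normal_no_beta)

text \<open>Confluence provides a common reduct, and a normal term reduces only to itself.\<close>

lemma beta_eq_normal: "beta_eq t n \<Longrightarrow> normal n \<Longrightarrow> beta\<^sup>*\<^sup>* t n"
  using confluentp_beta normal_betas
  unfolding beta_eq_def
  by (metis (no_types, lifting) conversepD equivclp_def confluentp_imp_semiconfluentp
      relcomppE rtranclp_conversep semiconfluentp_equivclp)

lemma betas_beta_eq: "beta\<^sup>*\<^sup>* t u \<Longrightarrow> beta_eq t u"
  unfolding beta_eq_def by (induction rule: rtranclp_induct) (auto intro: equivclp_into_equivclp)

subsection \<open>Weak head reduction and standardization\<close>

inductive_cases whr1_LamE: "whr1 (Lam s) u"
inductive_cases whr1_VarE: "whr1 (Var n) u"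
inductive_cases whr1_AppE: "whr1 (App s t) u"

lemma whr1_beta: "whr1 t u \<Longrightarrow> beta t u"
  by (induction rule: whr1.induct) (auto intro: beta.intros)

lemma whr1_det: "whr1 t u \<Longrightarrow> whr1 t u' \<Longrightarrow> u' = u"
  by (induction arbitrary: u' rule: whr1.induct) (blast elim: whr1_LamE whr1_AppE)+

lemma whr1_sub: "whr1 t u \<Longrightarrow> whr1 (sub \<sigma> t) (sub \<sigma> u)"
  by (induction rule: whr1.induct) (auto intro: whr1.intros simp: sub_sub_inst)

lemma whr_sub: "whr t u \<Longrightarrow> whr (sub \<sigma> t) (sub \<sigma> u)"
  unfolding whr_def
  by (induction rule: rtranclp_induct) (rule rtranclp.rtrancl_refl, erule rtranclp.rtrancl_into_rtrancl, erule whr1_sub)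

lemma whr_ren: "whr t u \<Longrightarrow> whr (ren r t) (ren r u)"
  by (simp add: ren_eq_sub whr_sub)

lemma whr_app: "whr s s' \<Longrightarrow> whr (App s t) (App s' t)"
  unfolding whr_def
  by (induction rule: rtranclp_induct) (rule rtranclp.rtrancl_refl, erule rtranclp.rtrancl_into_rtrancl, erule whr1.app)

lemma whr_refl [simp]: "whr t t"
  by (simp add: whr_def)

lemma whr_trans: "whr t u \<Longrightarrow> whr u v \<Longrightarrow> whr t v"
  unfolding whr_def by (rule rtranclp_trans)

lemma whr1_whr: "whr1 t u \<Longrightarrow> whr t u"
  by (auto simp: whr_def)

text \<open>Kashima's characterization of standard reduction.\<close>
inductive st :: "tm \<Rightarrow> tm \<Rightarrow> bool" where
  var: "whr t (Var n) \<Longrightarrow> st t (Var n)"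
| app: "whr t (App p q) \<Longrightarrow> st p p' \<Longrightarrow> st q q' \<Longrightarrow> st t (App p' q')"
| lam: "whr t (Lam p) \<Longrightarrow> st p p' \<Longrightarrow> st t (Lam p')"

inductive_cases st_VarE: "st t (Var n)"
inductive_cases st_AppE: "st t (App p q)"
inductive_cases st_LamE: "st t (Lam p)"

lemma st_refl: "st t t"
  by (induction t) (rule st.intros, rule whr_refl, assumption?, assumption?)+

lemma whr_st: "whr t u \<Longrightarrow> st u v \<Longrightarrow> st t v"
  by (erule st.cases) (auto intro: st.intros whr_trans)

lemma st_ren: "st t u \<Longrightarrow> st (ren r t) (ren r u)"
proof (induction arbitrary: r rule: st.induct)
  case (var t n) from whr_ren[OF this, of r] show ?case by (simp add: st.var)
next
  case (app t p q p' q') from whr_ren[OF app(1), of r] app show ?case by (simp add: st.app)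
next
  case (lam t p p') from whr_ren[OF lam(1), of r] lam show ?case by (simp add: st.lam)
qed

lemma st_sub: "st t u \<Longrightarrow> (\<And>i. st (\<sigma> i) (\<tau> i)) \<Longrightarrow> st (sub \<sigma> t) (sub \<tau> u)"
proof (induction arbitrary: \<sigma> \<tau> rule: st.induct)
  case (var t n)
  from whr_sub[OF var(1), of \<sigma>] var(2) show ?case by (simp add: whr_st)
next
  case (app t p q p' q')
  from whr_sub[OF app(1), of \<sigma>] app show ?case by (simp add: st.app)
next
  case (lam t p p')
  have "st (ups \<sigma> i) (ups \<tau> i)" for i
    using lam.prems by (cases i) (auto intro: st_refl st_ren)
  from whr_sub[OF lam(1), of \<sigma>] lam.IH[OF this] show ?case by (simp add: st.lam)
qed

text \<open>A further step is absorbed into a standard reduction. If it contracts a root redex, its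
  ancestor in \<open>t\<close> can be exposed by weak head reduction alone and contracted there;
  \<open>st_sub\<close> then supplies the rest.\<close>

lemma st_beta: "beta u v \<Longrightarrow> st t u \<Longrightarrow> st t v"
proof (induction arbitrary: t rule: beta.induct)
  case (redex s q)
  then obtain p q' s' where *: "whr t (App p q')" "whr p (Lam s')" "st s' s" "st q' q"
    by (blast elim: st_AppE st_LamE)
  have "whr t (sub (inst q') s')"
    using *(1,2) whr_app[of p "Lam s'" q'] whr1_whr[OF whr1.head] whr_trans by blast
  moreover have "st (sub (inst q') s') (sub (inst q) s)"
    by (rule st_sub[OF *(3)]) (auto simp: inst_def * intro: st_refl split: nat.split)
  ultimately show ?case by (rule whr_st)
next
  case (appL s s' q)
  from appL.prems show ?case by (rule st_AppE) (rule st.app, assumption, erule appL.IH)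
next
  case (appR q q' s)
  from appR.prems show ?case by (rule st_AppE) (rule st.app, assumption, assumption, erule appR.IH)
next
  case (lam q q')
  from lam.prems show ?case by (rule st_LamE) (rule st.lam, assumption, erule lam.IH)
qed

text \<open>The standardization theorem. It allows every term equivalent to a normal form to be
  analysed along the constructors of that normal form, with weak head steps only.\<close>

lemma betas_st: "beta\<^sup>*\<^sup>* t u \<Longrightarrow> st t u"
  by (induction rule: rtranclp_induct) (rule st_refl, erule st_beta)

subsection \<open>Types\<close>

lemma mem_ftv_Forall [simp]: "i \<in> ftv (Forall A) \<longleftrightarrow> Suc i \<in> ftv A"
proof
  assume "Suc i \<in> ftv A"
  then have "Suc i - 1 \<in> (\<lambda>n. n - 1) ` (ftv A - {0})" by (intro imageI) simp
  then show "i \<in> ftv (Forall A)" by simp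
next
  assume "i \<in> ftv (Forall A)"
  then obtain k where "i = k - 1" "k \<in> ftv A" "k \<noteq> 0" by auto
  then show "Suc i \<in> ftv A" by (cases k) auto
qed

declare ftv.simps(6) [simp del]

lemma tups_simps [simp]: "tups s 0 = TV 0" "tups s (Suc n) = tren Suc (s n)"
  by (simp_all add: tups_def)

lemma tinst_simps [simp]: "tinst C 0 = C" "tinst C (Suc n) = TV n"
  by (simp_all add: tinst_def)

lemma tups_TV: "tups (\<lambda>n. TV (r n)) = (\<lambda>n. TV (upr r n))"
  by (rule ext) (simp add: tups_def upr_def split: nat.split)

lemma tren_eq_tsub: "tren r A = tsub (\<lambda>n. TV (r n)) A"
  by (induction A arbitrary: r) (simp_all add: tups_TV)

lemma tsub_TV [simp]: "tsub TV A = A"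
proof (induction A)
  case (Forall A)
  have "tups TV = TV" by (rule ext) (simp add: tups_def split: nat.split)
  with Forall show ?case by simp
qed simp_all

lemma tsub_tren: "tsub s (tren r A) = tsub (\<lambda>n. s (r n)) A"
proof (induction A arbitrary: s r)
  case (Forall A)
  have "(\<lambda>n. tups s (upr r n)) = tups (\<lambda>n. s (r n))"
    by (rule ext) (simp add: tups_def upr_def split: nat.split)
  with Forall show ?case by simp
qed simp_all

lemma tren_tren: "tren r (tren r' A) = tren (\<lambda>n. r (r' n)) A"
  by (simp add: tren_eq_tsub[of r] tsub_tren) (simp add: tren_eq_tsub)

lemma tren_tsub: "tren r (tsub s A) = tsub (\<lambda>n. tren r (s n)) A"
proof (induction A arbitrary: s r)
  case (Forall A)
  have "(\<lambda>n. tren (upr r) (tups s n)) = tups (\<lambda>n. tren r (s n))"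
    by (rule ext) (simp add: tups_def tren_tren split: nat.split)
  with Forall show ?case by simp
qed simp_all

lemma tsub_tsub: "tsub s (tsub s' A) = tsub (\<lambda>n. tsub s (s' n)) A"
proof (induction A arbitrary: s s')
  case (Forall A)
  have "(\<lambda>n. tsub (tups s) (tups s' n)) = tups (\<lambda>n. tsub s (s' n))"
    by (rule ext) (simp add: tups_def tsub_tren tren_tsub split: nat.split)
  with Forall show ?case by simp
qed simp_all

lemma tsub_tinst_tren: "tsub (tinst C) (tren Suc A) = A"
  by (simp add: tsub_tren)

lemma tsub_tups_tren: "tsub (tups s) (tren Suc A) = tren Suc (tsub s A)"
  by (simp add: tsub_tren tren_tsub)

lemma tsub_tinst_tups: "tsub (tinst C) (tsub (tups s) A) = tsub (case_nat C s) A"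
proof -
  have "(\<lambda>n. tsub (tinst C) (tups s n)) = case_nat C s"
    by (rule ext) (simp add: tsub_tinst_tren split: nat.split)
  then show ?thesis by (simp add: tsub_tsub)
qed

lemma tsub_tsub_tinst: "tsub s (tsub (tinst C) A) = tsub (tinst (tsub s C)) (tsub (tups s) A)"
proof -
  have "(\<lambda>n. tsub s (tinst C n)) = case_nat (tsub s C) s"
    by (rule ext) (simp add: tinst_def split: nat.split)
  then show ?thesis by (simp add: tsub_tinst_tups tsub_tsub[of s "tinst C"])
qed

lemma tsub_case_nat_tren: "tsub (case_nat C s) (tren Suc A) = tsub s A"
  by (simp add: tsub_tren)

lemma ftv_tren: "i \<in> ftv A \<Longrightarrow> r i \<in> ftv (tren r A)"
proof (induction A arbitrary: i r)
  case (Forall A)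
  then show ?case using Forall.IH[of "Suc i" "upr r"] by simp
qed auto

lemma ftv_tsub: "i \<in> ftv A \<Longrightarrow> j \<in> ftv (s i) \<Longrightarrow> j \<in> ftv (tsub s A)"
proof (induction A arbitrary: i j s)
  case (Forall A)
  then show ?case using Forall.IH[of "Suc i" "Suc j" "tups s"] by (simp add: ftv_tren)
qed auto

text \<open>Keeps the properness condition of quantification stable under substitution, since
  \<open>tups\<close> fixes the bound index 0.\<close>

lemma ftv_tups: "0 \<in> ftv A \<Longrightarrow> 0 \<in> ftv (tsub (tups s) A)"
  by (rule ftv_tsub[of 0]) simp_all

lemma proper_tren: "proper A \<Longrightarrow> proper (tren r A)"
proof (induction A arbitrary: r)
  case (Forall A)
  then show ?case using ftv_tren[of 0 A "upr r"] by simp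
qed simp_all

lemma proper_tups: "(\<And>n. proper (s n)) \<Longrightarrow> proper (tups s n)"
  by (cases n) (simp_all add: proper_tren)

lemma proper_tsub: "proper A \<Longrightarrow> (\<And>n. proper (s n)) \<Longrightarrow> proper (tsub s A)"
proof (induction A arbitrary: s)
  case (Forall A)
  then show ?case using Forall.IH[of "tups s"] proper_tups[of s] by (simp add: ftv_tups)
qed simp_all

lemma proper_tinst: "proper C \<Longrightarrow> proper (tinst C n)"
  by (cases n) simp_all

lemma proper_case_nat: "proper C \<Longrightarrow> (\<And>n. proper (s n)) \<Longrightarrow> proper (case_nat C s n)"
  by (cases n) simp_all

subsection \<open>Structural properties of typing\<close>

lemma typing_proper: "typing e \<Gamma> t A \<Longrightarrow> \<forall>B\<in>set \<Gamma>. proper B \<Longrightarrow> proper A"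
  by (induction rule: typing.induct)
    (simp_all add: proper_tsub proper_tinst proper_tren)

lemma typing_fv: "typing e \<Gamma> t A \<Longrightarrow> i \<in> fv t \<Longrightarrow> i < length \<Gamma>"
  by (induction arbitrary: i rule: typing.induct) fastforce+

lemma typing_tsub:
  "typing e \<Gamma> t A \<Longrightarrow> (\<And>n. proper (s n)) \<Longrightarrow> typing e (map (tsub s) \<Gamma>) t (tsub s A)"
proof (induction arbitrary: s rule: typing.induct)
  case (ax i \<Gamma> e)
  then show ?case using typing.ax[of i "map (tsub s) \<Gamma>" e] by simp
next
  case (arr_i B e \<Gamma> t C)
  then show ?case by (simp add: typing.arr_i proper_tsub)
next
  case (arr_e e \<Gamma> u B C v)
  have "typing e (map (tsub s) \<Gamma>) u (tsub s (Arr B C))" by (rule arr_e.IH) (rule arr_e.prems)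
  moreover have "typing e (map (tsub s) \<Gamma>) v (tsub s B)" by (rule arr_e.IH) (rule arr_e.prems)
  ultimately show ?case by (simp add: typing.arr_e)
next
  case (all_i e \<Gamma> t A)
  have "typing e (map (tsub (tups s)) (map (tren Suc) \<Gamma>)) t (tsub (tups s) A)"
    by (rule all_i.IH) (simp add: proper_tups all_i.prems)
  moreover have "map (tsub (tups s)) (map (tren Suc) \<Gamma>) = map (tren Suc) (map (tsub s) \<Gamma>)"
    by (simp add: tsub_tups_tren)
  ultimately show ?case by (simp only:) (simp add: typing.all_i ftv_tups all_i.hyps)
next
  case (all_e e \<Gamma> t A C)
  have "typing e (map (tsub s) \<Gamma>) t (Forall (tsub (tups s) A))"
    using all_e.IH[OF all_e.prems] by simp
  moreover have "proper (tsub s C)" by (simp add: proper_tsub all_e)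
  ultimately show ?case by (simp add: typing.all_e all_e.hyps tsub_tsub_tinst)
qed

lemma typing_tren: "typing e \<Gamma> t A \<Longrightarrow> typing e (map (tren r) \<Gamma>) t (tren r A)"
  using typing_tsub[of e \<Gamma> t A "\<lambda>n. TV (r n)"] by (simp add: tren_eq_tsub[abs_def])

lemma typing_ren:
  "typing e \<Gamma> t A \<Longrightarrow> (\<And>i. i \<in> fv t \<Longrightarrow> r i < length \<Delta> \<and> \<Delta> ! r i = \<Gamma> ! i) \<Longrightarrow>
    typing e \<Delta> (ren r t) A"
proof (induction arbitrary: r \<Delta> rule: typing.induct)
  case (ax i \<Gamma> e)
  then have "r i < length \<Delta> \<and> \<Delta> ! r i = \<Gamma> ! i" by simp
  with typing.ax[of "r i" \<Delta> e] show ?case by simp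
next
  case (arr_i B e \<Gamma> t C)
  have "typing e (B # \<Delta>) (ren (upr r) t) C"
  proof (rule arr_i.IH)
    fix i assume "i \<in> fv t"
    then show "upr r i < length (B # \<Delta>) \<and> (B # \<Delta>) ! upr r i = (B # \<Gamma>) ! i"
      using arr_i.prems[of "i - 1"] by (cases i) simp_all
  qed
  with arr_i.hyps show ?case by (simp add: typing.arr_i)
next
  case (arr_e e \<Gamma> u B C v)
  have "typing e \<Delta> (ren r u) (Arr B C)" "typing e \<Delta> (ren r v) B"
    by (rule arr_e.IH, rule arr_e.prems, simp)+
  then show ?case by (simp add: typing.arr_e)
next
  case (all_i e \<Gamma> t A)
  have "typing e (map (tren Suc) \<Delta>) (ren r t) A"
  proof (rule all_i.IH)
    fix i assume "i \<in> fv t"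
    with all_i.prems typing_fv[OF all_i.hyps(1)]
    show "r i < length (map (tren Suc) \<Delta>) \<and> map (tren Suc) \<Delta> ! r i = map (tren Suc) \<Gamma> ! i"
      by simp
  qed
  with all_i.hyps show ?case by (simp add: typing.all_i)
next
  case (all_e e \<Gamma> t A C)
  have "typing e \<Delta> (ren r t) (Forall A)" by (rule all_e.IH) (rule all_e.prems)
  with all_e.hyps show ?case by (simp add: typing.all_e)
qed

lemma typing_weaken: "typing e \<Gamma> t A \<Longrightarrow> typing e (\<Gamma> @ \<Gamma>') t A"
  using typing_ren[of e \<Gamma> t A "\<lambda>n. n" "\<Gamma> @ \<Gamma>'"] typing_fv[of e \<Gamma> t A]
  by (simp add: nth_append ren_eq_sub trans_less_add1)

lemma typing_shift: "typing e \<Gamma> t A \<Longrightarrow> typing e (B # \<Gamma>) (ren Suc t) A"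
  using typing_ren[of e \<Gamma> t A Suc "B # \<Gamma>"] typing_fv[of e \<Gamma> t A] by simp

text \<open>Only the values at free variables of \<open>t\<close> need a type, so a term without
  free variables can be carried over to the empty context.\<close>

lemma typing_sub:
  "typing e \<Gamma> t A \<Longrightarrow> (\<And>i. i \<in> fv t \<Longrightarrow> typing e \<Delta> (\<sigma> i) (\<Gamma> ! i)) \<Longrightarrow>
    typing e \<Delta> (sub \<sigma> t) A"
proof (induction arbitrary: \<sigma> \<Delta> rule: typing.induct)
  case (ax i \<Gamma> e)
  then show ?case by simp
next
  case (arr_i B e \<Gamma> t C)
  have "typing e (B # \<Delta>) (sub (ups \<sigma>) t) C"
  proof (rule arr_i.IH)
    fix i assume i: "i \<in> fv t"
    show "typing e (B # \<Delta>) (ups \<sigma> i) ((B # \<Gamma>) ! i)"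
    proof (cases i)
      case 0
      then show ?thesis using typing.ax[of 0 "B # \<Delta>" e] by simp
    next
      case (Suc k)
      with i have "typing e \<Delta> (\<sigma> k) (\<Gamma> ! k)" by (intro arr_i.prems) simp
      with Suc show ?thesis by (simp add: typing_shift)
    qed
  qed
  with arr_i.hyps show ?case by (simp add: typing.arr_i)
next
  case (arr_e e \<Gamma> u B C v)
  have "typing e \<Delta> (sub \<sigma> u) (Arr B C)" "typing e \<Delta> (sub \<sigma> v) B"
    by (rule arr_e.IH, rule arr_e.prems, simp)+
  then show ?case by (simp add: typing.arr_e)
next
  case (all_i e \<Gamma> t A)
  have "typing e (map (tren Suc) \<Delta>) (sub \<sigma> t) A"
  proof (rule all_i.IH)
    fix i assume "i \<in> fv t"
    with all_i.prems[OF this] typing_fv[OF all_i.hyps(1)]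
    show "typing e (map (tren Suc) \<Delta>) (\<sigma> i) (map (tren Suc) \<Gamma> ! i)"
      by (simp add: typing_tren)
  qed
  with all_i.hyps show ?case by (simp add: typing.all_i)
next
  case (all_e e \<Gamma> t A C)
  have "typing e \<Delta> (sub \<sigma> t) (Forall A)" by (rule all_e.IH) (rule all_e.prems)
  with all_e.hyps show ?case by (simp add: typing.all_e)
qed

lemma typing_sub_inst:
  assumes "typing e (B # \<Gamma>) t A" "typing e \<Gamma> u B"
  shows "typing e \<Gamma> (sub (inst u) t) A"
proof (rule typing_sub[OF assms(1)])
  fix i assume "i \<in> fv t"
  with typing_fv[OF assms(1)] have "i < Suc (length \<Gamma>)" by simp
  then show "typing e \<Gamma> (inst u i) ((B # \<Gamma>) ! i)"
    using assms(2) typing.ax[of "i - 1" \<Gamma> e] by (cases i) simp_all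
qed

subsection \<open>Generation and subject reduction\<close>

fun is_Forall :: "ty \<Rightarrow> bool" where
  "is_Forall (Forall A) = True"
| "is_Forall _ = False"

text \<open>Instantiation of all leading quantifiers, including those created by the instantiation.\<close>
inductive insts :: "ty \<Rightarrow> ty \<Rightarrow> bool" where
  base: "\<not> is_Forall A \<Longrightarrow> insts A A"
| step: "proper C \<Longrightarrow> insts (tsub (tinst C) A) B \<Longrightarrow> insts (Forall A) B"

inductive_cases insts_ForallE: "insts (Forall A) B"
inductive_cases insts_ArrE: "insts (Arr A A') B"

lemma insts_Arr [simp]: "insts (Arr A A') B \<longleftrightarrow> B = Arr A A'"
  by (auto elim: insts_ArrE intro: insts.intros)

lemma insts_TBot: "insts TBot TBot"
  by (rule insts.base) simp

lemma typF_insts: "insts A B \<Longrightarrow> typF \<Gamma> t A \<Longrightarrow> typF \<Gamma> t B"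
  by (induction rule: insts.induct) (auto intro: typing.all_e)

text \<open>Quantifying over all type substitutions lets the rule all_i pass through the induction.\<close>
lemma typF_generation_tsub:
  "typing e \<Gamma> t A \<Longrightarrow> (\<And>n. proper (s n)) \<Longrightarrow> insts (tsub s A) R \<Longrightarrow> e \<Longrightarrow>
    (case t of
      Var i \<Rightarrow> insts (tsub s (\<Gamma> ! i)) R
    | Lam t' \<Rightarrow> (\<exists>B C. R = Arr B C \<and> typF (B # map (tsub s) \<Gamma>) t' C)
    | App u v \<Rightarrow> (\<exists>B C. typF (map (tsub s) \<Gamma>) u (Arr B C) \<and> typF (map (tsub s) \<Gamma>) v B \<and> insts C R))"
proof (induction arbitrary: s rule: typing.induct)
  case (ax i \<Gamma> e)
  then show ?case by simp
next
  case (arr_i B e \<Gamma> t C)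
  with typing_tsub[OF arr_i.hyps(2), of s] show ?case by simp
next
  case (arr_e e \<Gamma> u B C v)
  with typing_tsub[OF arr_e.hyps(1), of s] typing_tsub[OF arr_e.hyps(2), of s]
  show ?case by auto
next
  case (all_i e \<Gamma> t A)
  from all_i.prems(2) obtain C where C: "proper C" "insts (tsub (tinst C) (tsub (tups s) A)) R"
    by (auto elim: insts_ForallE)
  \<comment> \<open>In the variable case the shifted context is looked up at \<open>i\<close>, and
    the shift can be moved past the lookup only for an index in range.\<close>
  have len: "i < length \<Gamma>" if "t = Var i" for i
    using typing_fv[OF all_i.hyps(1), of i] that by simp
  \<comment> \<open>The type chosen for the quantified variable becomes the first entry of the
    substitution, and the shifted context does not see it.\<close>
  have "\<And>n. proper (case_nat C s n)" by (rule proper_case_nat[OF C(1) all_i.prems(1)])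
  from all_i.IH[OF this C(2)[unfolded tsub_tinst_tups] all_i.prems(3)] len show ?case
    by (auto simp: tsub_case_nat_tren comp_def split: tm.splits)
next
  case (all_e e \<Gamma> t A C)
  have "insts (tsub s (Forall A)) R"
    using all_e.prems(2) by (auto intro!: insts.step[of "tsub s C"] simp: tsub_tsub_tinst proper_tsub all_e)
  from all_e.IH[OF all_e.prems(1) this all_e.prems(3)] show ?case .
qed

lemma map_tsub_TV [simp]: "map (tsub TV) \<Gamma> = \<Gamma>"
  by (induction \<Gamma>) simp_all

lemma typF_Lam: "typF \<Gamma> (Lam t) A \<Longrightarrow> insts A R \<Longrightarrow> \<exists>B C. R = Arr B C \<and> typF (B # \<Gamma>) t C"
  using typF_generation_tsub[of True \<Gamma> "Lam t" A TV R] by simp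

lemma typF_App:
  "typF \<Gamma> (App u v) A \<Longrightarrow> insts A R \<Longrightarrow> \<exists>B C. typF \<Gamma> u (Arr B C) \<and> typF \<Gamma> v B \<and> insts C R"
  using typF_generation_tsub[of True \<Gamma> "App u v" A TV R] by simp

lemma typF_Var: "typF \<Gamma> (Var i) A \<Longrightarrow> insts A R \<Longrightarrow> insts (\<Gamma> ! i) R"
  using typF_generation_tsub[of True \<Gamma> "Var i" A TV R] by simp

text \<open>An arrow has no leading quantifier, so for a root redex generation recovers exactly the
  argument type and the typing of the body; \<open>typing_sub_inst\<close> concludes. The quantifier
  rules keep the term and pass through the induction.\<close>

lemma subject_reduction_step: "typing e \<Gamma> t A \<Longrightarrow> e \<Longrightarrow> beta t t' \<Longrightarrow> typing e \<Gamma> t' A"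
proof (induction arbitrary: t' rule: typing.induct)
  case (ax i \<Gamma> e)
  from \<open>beta (Var i) t'\<close> show ?case by cases
next
  case (arr_i B e \<Gamma> t C)
  from \<open>beta (Lam t) t'\<close> show ?case
    by cases (auto intro: typing.arr_i arr_i)
next
  case (arr_e e \<Gamma> u B C v)
  from \<open>beta (App u v) t'\<close> show ?case
  proof cases
    case (redex s)
    with arr_e.hyps(1) arr_e.prems typF_Lam[of \<Gamma> s "Arr B C" "Arr B C"]
    have "typF (B # \<Gamma>) s C" by auto
    with redex arr_e show ?thesis by (simp add: typing_sub_inst)
  qed (auto intro: typing.arr_e arr_e)
next
  case (all_i e \<Gamma> t A)
  then show ?case by (blast intro: typing.all_i)
next
  case (all_e e \<Gamma> t A C)
  then show ?case by (blast intro: typing.all_e)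
qed

lemma subject_reduction: "beta\<^sup>*\<^sup>* t t' \<Longrightarrow> typF \<Gamma> t A \<Longrightarrow> typF \<Gamma> t' A"
  by (induction rule: rtranclp_induct) (simp_all add: subject_reduction_step)

subsection \<open>Normalization\<close>

text \<open>Neutral and normalizing terms, described along leftmost reduction. One notion thus
  yields both a normal form and termination of weak head reduction.\<close>

inductive NE :: "tm \<Rightarrow> bool" and NN :: "tm \<Rightarrow> bool" where
  NE_Var: "NE (Var n)"
| NE_App: "NE s \<Longrightarrow> NN t \<Longrightarrow> NE (App s t)"
| NN_NE: "NE t \<Longrightarrow> NN t"
| NN_Lam: "NN t \<Longrightarrow> NN (Lam t)"
| NN_whr1: "whr1 t t' \<Longrightarrow> NN t' \<Longrightarrow> NN t"

text \<open>Neutral terms and abstractions are stuck, and by determinism accessibility of the single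
  reduct is enough in the expansion case.\<close>

lemma NE_no_whr1_NN_acc:
  shows "NE t \<Longrightarrow> \<not> whr1 t u" and "NN t \<Longrightarrow> Wellfounded.accp whr1\<inverse>\<inverse> t"
proof (induction arbitrary: u rule: NE_NN.inducts)
  case (NE_App s t)
  from NE_App.hyps(1) have "\<not> s = Lam s'" for s' by (auto elim: NE.cases)
  with NE_App.IH(1) show ?case by (blast elim: whr1_AppE)
next
  case (NN_whr1 t t')
  show ?case
  proof (rule accp.accI)
    fix u assume "whr1\<inverse>\<inverse> u t"
    then have "u = t'" using whr1_det[OF NN_whr1.hyps(1), of u] by simp
    with NN_whr1.IH show "Wellfounded.accp whr1\<inverse>\<inverse> u" by blast
  qed
qed (auto intro: accp.accI elim: whr1_VarE whr1_LamE)

text \<open>For neutral terms the normal form must also not be an abstraction; otherwise applying it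
  could create a redex.\<close>

lemma NE_NN_normalizes:
  shows "NE t \<Longrightarrow> \<exists>n. beta\<^sup>*\<^sup>* t n \<and> normal n \<and> (\<forall>s. n \<noteq> Lam s)"
    and "NN t \<Longrightarrow> \<exists>n. beta\<^sup>*\<^sup>* t n \<and> normal n"
proof (induction rule: NE_NN.inducts)
  case (NE_Var n)
  show ?case by (rule exI[of _ "Var n"]) simp
next
  case (NE_App s t)
  then obtain m n where *: "beta\<^sup>*\<^sup>* s m" "normal m" "\<forall>s. m \<noteq> Lam s" "beta\<^sup>*\<^sup>* t n" "normal n" by blast
  then show ?case by (intro exI[of _ "App m n"]) (simp add: betas_app)
next
  case (NN_NE t)
  then show ?case by blast
next
  case (NN_Lam t)
  then obtain n where "beta\<^sup>*\<^sup>* t n" "normal n" by blast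
  then show ?case by (intro exI[of _ "Lam n"]) (simp add: betas_lam)
next
  case (NN_whr1 t t')
  then show ?case by (meson converse_rtranclp_into_rtranclp whr1_beta)
qed

text \<open>Renaming creates no abstraction, so each head redex of the renamed term comes from one
  of the original.\<close>

lemma whr1_ren_inv: "whr1 (ren r t) u \<Longrightarrow> \<exists>t'. u = ren r t' \<and> whr1 t t'"
proof (induction t arbitrary: u)
  case (App t1 t2)
  from App.prems have "whr1 (App (ren r t1) (ren r t2)) u" by simp
  then consider (1) s where "ren r t1 = Lam s" "u = sub (inst (ren r t2)) s"
    | (2) s' where "u = App s' (ren r t2)" "whr1 (ren r t1) s'"
    by (rule whr1_AppE) blast+
  then show ?case
  proof cases
    case (1 s)
    then obtain s' where "t1 = Lam s'" "s = ren (upr r) s'" by (cases t1) auto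
    with 1 show ?thesis by (metis ren_sub_inst whr1.head)
  next
    case (2 s')
    with App.IH(1) show ?thesis by (metis ren.simps(2) whr1.app)
  qed
qed (auto elim: whr1_VarE whr1_LamE)

lemma NE_NN_ren_inv:
  shows "NE t \<Longrightarrow> t = ren r u \<Longrightarrow> NE u" and "NN t \<Longrightarrow> t = ren r u \<Longrightarrow> NN u"
proof (induction arbitrary: r u and r u rule: NE_NN.inducts)
  case (NE_Var n)
  then show ?case by (cases u) (auto intro: NE_NN.intros)
next
  case (NE_App s t)
  then show ?case by (cases u) (auto intro: NE_NN.intros)
next
  case (NN_NE t)
  then show ?case by (blast intro: NE_NN.intros)
next
  case (NN_Lam t)
  then show ?case by (cases u) (auto intro: NE_NN.intros)
next
  case (NN_whr1 t t')
  from NN_whr1.hyps(1) NN_whr1.prems obtain u' where "t' = ren r u'" "whr1 u u'"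
    using whr1_ren_inv by blast
  with NN_whr1.IH show ?case by (blast intro: NE_NN.intros)
qed

text \<open>Contracting a redex whose argument is a variable is a mere renaming, which
  \<open>NE_NN_ren_inv\<close> undoes. This shows that the function space of saturated sets contains
  only normalizing terms.\<close>

lemma NN_App_Var: "NN t \<Longrightarrow> t = App u (Var n) \<Longrightarrow> NN u"
\<comment> \<open>The trivial predicate on the neutral side confines the mutual induction to
  \<open>NN\<close>.\<close>
proof (induction arbitrary: u rule: NE_NN.inducts(2)[where ?P1.0 = "\<lambda>_. True"])
  case (NN_NE t)
  then show ?case by (auto elim: NE.cases intro: NE_NN.intros)
next
  case (NN_whr1 t t')
  from NN_whr1.hyps(1)[unfolded NN_whr1.prems]
  consider (1) s where "u = Lam s" "t' = sub (inst (Var n)) s"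
    | (2) s' where "t' = App s' (Var n)" "whr1 u s'"
    by (rule whr1_AppE) blast+
  then show ?case
  proof cases
    case (1 s)
    have "inst (Var n) = (\<lambda>i. Var (case_nat n id i))"
      by (rule ext) (simp add: inst_def split: nat.split)
    with 1 have "t' = ren (case_nat n id) s" by (simp add: ren_eq_sub)
    from NE_NN_ren_inv(2)[OF NN_whr1.hyps(2) this] 1 show ?thesis by (simp add: NN_Lam)
  next
    case (2 s')
    with NN_whr1.IH show ?thesis by (blast intro: NE_NN.intros)
  qed
qed simp_all

section \<open>Saturated sets and adequacy of their interpretation of types\<close>

definition sat :: "tm set \<Rightarrow> bool" where
  "sat X \<longleftrightarrow> X \<subseteq> Collect NN \<and> Collect NE \<subseteq> X \<and> (\<forall>t u. whr1 t u \<longrightarrow> u \<in> X \<longrightarrow> t \<in> X)"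

text \<open>Girard's reducibility: a quantifier is the intersection over all saturated sets, and the
  constants receive the largest one.\<close>

fun interp :: "(nat \<Rightarrow> tm set) \<Rightarrow> ty \<Rightarrow> tm set" where
  "interp \<xi> (TV n) = \<xi> n"
| "interp \<xi> TO = Collect NN"
| "interp \<xi> TBot = Collect NN"
| "interp \<xi> (TC c) = Collect NN"
| "interp \<xi> (Arr A B) = {u. \<forall>v\<in>interp \<xi> A. App u v \<in> interp \<xi> B}"
| "interp \<xi> (Forall A) = {t. \<forall>X. sat X \<longrightarrow> t \<in> interp (case_nat X \<xi>) A}"

lemma sat_NN: "sat (Collect NN)"
  by (auto simp: sat_def intro: NE_NN.intros)

lemma sat_case_nat: "sat X \<Longrightarrow> (\<And>n. sat (\<xi> n)) \<Longrightarrow> sat (case_nat X \<xi> n)"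
  by (cases n) simp_all

lemma satI:
  "(\<And>t. t \<in> X \<Longrightarrow> NN t) \<Longrightarrow> (\<And>t. NE t \<Longrightarrow> t \<in> X) \<Longrightarrow> (\<And>t u. whr1 t u \<Longrightarrow> u \<in> X \<Longrightarrow> t \<in> X) \<Longrightarrow> sat X"
  by (simp add: sat_def subset_iff)

lemma sat_imp_NN: "sat X \<Longrightarrow> t \<in> X \<Longrightarrow> NN t"
  by (auto simp: sat_def)

lemma NE_in_sat: "sat X \<Longrightarrow> NE t \<Longrightarrow> t \<in> X"
  by (auto simp: sat_def)

lemma whr1_in_sat: "sat X \<Longrightarrow> whr1 t u \<Longrightarrow> u \<in> X \<Longrightarrow> t \<in> X"
  by (simp add: sat_def)

lemma sat_interp: "(\<And>n. sat (\<xi> n)) \<Longrightarrow> sat (interp \<xi> A)"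
proof (induction A arbitrary: \<xi>)
  case (Arr A B)
  have A: "sat (interp \<xi> A)" and B: "sat (interp \<xi> B)" by (rule Arr.IH, rule Arr.prems)+
  show ?case
  proof (rule satI)
    fix u assume "u \<in> interp \<xi> (Arr A B)"
    \<comment> \<open>\<open>Var 0\<close> is an arbitrary choice: a saturated set contains every
      neutral term, so the argument set is inhabited.\<close>
    with NE_in_sat[OF A NE_Var] have "App u (Var 0) \<in> interp \<xi> B" by simp
    then show "NN u" using NN_App_Var[OF _ refl] sat_imp_NN[OF B] by blast
  next
    fix u assume "NE u"
    then have "NE (App u v)" if "v \<in> interp \<xi> A" for v
      using that by (blast intro: NE_App sat_imp_NN[OF A])
    with NE_in_sat[OF B] show "u \<in> interp \<xi> (Arr A B)" by simp
  next
    fix t u assume "whr1 t u" "u \<in> interp \<xi> (Arr A B)"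
    with whr1_in_sat[OF B whr1.app[OF \<open>whr1 t u\<close>]] show "t \<in> interp \<xi> (Arr A B)" by simp
  qed
next
  case (Forall A)
  have IH: "sat (interp (case_nat X \<xi>) A)" if "sat X" for X
    by (rule Forall.IH) (rule sat_case_nat[OF that Forall.prems])
  show ?case
  proof (rule satI)
    fix t assume "t \<in> interp \<xi> (Forall A)"
    with sat_NN have "t \<in> interp (case_nat (Collect NN) \<xi>) A" by simp
    then show "NN t" by (rule sat_imp_NN[OF IH[OF sat_NN]])
  next
    fix t assume "NE t"
    with NE_in_sat[OF IH] show "t \<in> interp \<xi> (Forall A)" by simp
  next
    fix t u assume *: "whr1 t u" "u \<in> interp \<xi> (Forall A)"
    have "t \<in> interp (case_nat X \<xi>) A" if "sat X" for X
      using whr1_in_sat[OF IH[OF that] *(1)] *(2) that by simp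
    then show "t \<in> interp \<xi> (Forall A)" by simp
  qed
qed (simp_all add: sat_NN)

lemma interp_tren: "interp \<xi> (tren r A) = interp (\<lambda>n. \<xi> (r n)) A"
proof (induction A arbitrary: \<xi> r)
  case (Forall A)
  have "(\<lambda>n. case_nat X \<xi> (upr r n)) = case_nat X (\<lambda>n. \<xi> (r n))" for X
    by (rule ext) (simp split: nat.split)
  with Forall show ?case by simp
qed simp_all

lemma interp_tsub: "interp \<xi> (tsub s A) = interp (\<lambda>n. interp \<xi> (s n)) A"
proof (induction A arbitrary: \<xi> s)
  case (Forall A)
  have "(\<lambda>n. interp (case_nat X \<xi>) (tups s n)) = case_nat X (\<lambda>n. interp \<xi> (s n))" for X
    by (rule ext) (simp add: interp_tren split: nat.split)
  with Forall show ?case by simp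
qed simp_all

lemma adequacy:
  "typing e \<Gamma> t A \<Longrightarrow> (\<And>n. sat (\<xi> n)) \<Longrightarrow>
    (\<And>i. i < length \<Gamma> \<Longrightarrow> \<sigma> i \<in> interp \<xi> (\<Gamma> ! i)) \<Longrightarrow> sub \<sigma> t \<in> interp \<xi> A"
proof (induction arbitrary: \<sigma> \<xi> rule: typing.induct)
  case (ax i \<Gamma> e)
  then show ?case by simp
next
  case (arr_i B e \<Gamma> t C)
  have "App (Lam (sub (ups \<sigma>) t)) v \<in> interp \<xi> C" if v: "v \<in> interp \<xi> B" for v
  proof -
    have "sub (case_nat v \<sigma>) t \<in> interp \<xi> C"
    proof (rule arr_i.IH)
      fix i assume "i < length (B # \<Gamma>)"
      then show "case_nat v \<sigma> i \<in> interp \<xi> ((B # \<Gamma>) ! i)"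
        using v arr_i.prems(2) by (cases i) simp_all
    qed (rule arr_i.prems)
    moreover have "whr1 (App (Lam (sub (ups \<sigma>) t)) v) (sub (case_nat v \<sigma>) t)"
      using whr1.head[of "sub (ups \<sigma>) t" v] by (simp add: sub_inst_ups)
    ultimately show ?thesis by (metis whr1_in_sat sat_interp arr_i.prems(1))
  qed
  then show ?case by simp
next
  case (arr_e e \<Gamma> u B C v)
  have "sub \<sigma> u \<in> interp \<xi> (Arr B C)" "sub \<sigma> v \<in> interp \<xi> B"
    by (rule arr_e.IH, rule arr_e.prems, rule arr_e.prems, assumption)+
  then show ?case by simp
next
  case (all_i e \<Gamma> t A)
  have "sub \<sigma> t \<in> interp (case_nat X \<xi>) A" if "sat X" for X
  proof (rule all_i.IH)
    show "sat (case_nat X \<xi> n)" for n by (rule sat_case_nat[OF that all_i.prems(1)])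
    show "\<sigma> i \<in> interp (case_nat X \<xi>) (map (tren Suc) \<Gamma> ! i)" if "i < length (map (tren Suc) \<Gamma>)" for i
      using that all_i.prems(2) by (simp add: interp_tren)
  qed
  then show ?case by simp
next
  case (all_e e \<Gamma> t A C)
  have "sub \<sigma> t \<in> interp \<xi> (Forall A)"
    by (rule all_e.IH, rule all_e.prems, rule all_e.prems)
  \<comment> \<open>The impredicative point: the interpretation of the instantiating type is itself
    one of the sets over which the quantifier ranges.\<close>
  moreover have "sat (interp \<xi> C)" by (rule sat_interp) (rule all_e.prems)
  moreover have "(\<lambda>n. interp \<xi> (tinst C n)) = case_nat (interp \<xi> C) \<xi>"
    by (rule ext) (simp add: tinst_def split: nat.split)
  ultimately show ?case by (simp add: interp_tsub)
qed

lemma typing_NN: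
  assumes "typing e \<Gamma> t A"
  shows "NN t"
proof -
  \<comment> \<open>The identity substitution is admissible because variables are neutral and so
    belong to every interpretation.\<close>
  have "sub Var t \<in> interp (\<lambda>_. Collect NN) A"
  proof (rule adequacy[OF assms])
    show "Var i \<in> interp (\<lambda>_. Collect NN) (\<Gamma> ! i)" for i
      by (rule NE_in_sat[OF sat_interp[OF sat_NN] NE_Var])
  qed (rule sat_NN)
  from sat_imp_NN[OF sat_interp[OF sat_NN] this] show ?thesis by simp
qed

lemmas typing_normalizes = NE_NN_normalizes(2)[OF typing_NN]
lemmas typing_whr1_terminates = NE_no_whr1_NN_acc(2)[OF typing_NN]

subsection \<open>Applicative contexts\<close>

abbreviation apps :: "tm \<Rightarrow> tm list \<Rightarrow> tm" where
  "apps \<equiv> foldl App"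

lemma sub_apps: "sub \<sigma> (apps h as) = apps (sub \<sigma> h) (map (sub \<sigma>) as)"
  by (induction as arbitrary: h) simp_all

lemma whr1_apps: "whr1 t u \<Longrightarrow> whr1 (apps t as) (apps u as)"
  by (induction as arbitrary: t u) (simp_all add: whr1.app)

lemma whr_apps: "whr t u \<Longrightarrow> whr (apps t as) (apps u as)"
  by (induction as arbitrary: t u) (simp_all add: whr_app)

lemma fv_apps_head: "x \<in> fv h \<Longrightarrow> x \<in> fv (apps h as)"
  by (induction as arbitrary: h) simp_all

lemma whr_head_cases:
  obtains (step) t' where "whr1 t t'" | (Lam) s where "t = Lam s" | (Var) k as where "t = apps (Var k) as"
proof -
  have "(\<exists>t'. whr1 t t') \<or> (\<exists>s. t = Lam s) \<or> (\<exists>k as. t = apps (Var k) as)"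
  proof (induction t)
    case (Var k)
    have "Var k = apps (Var k) []" by simp
    then show ?case by blast
  next
    case (App t u)
    from App.IH(1) show ?case
    proof (elim disjE exE)
      fix k as assume "t = apps (Var k) as"
      then have "App t u = apps (Var k) (as @ [u])" by simp
      then show ?thesis by blast
    qed (auto intro: whr1.intros)
  qed simp
  with that show thesis by blast
qed

text \<open>Typed argument lists for a head of type \<open>A\<close>. The \<open>insts\<close>
  between the arguments absorb all instantiations, which the syntax of terms does not show.\<close>

inductive spine :: "ty list \<Rightarrow> ty \<Rightarrow> tm list \<Rightarrow> ty \<Rightarrow> bool" for \<Gamma> where
  Nil: "insts A R \<Longrightarrow> spine \<Gamma> A [] R"
| Cons: "insts A (Arr B C) \<Longrightarrow> typF \<Gamma> a B \<Longrightarrow> spine \<Gamma> C as R \<Longrightarrow> spine \<Gamma> A (a # as) R"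

lemma spine_snoc:
  "spine \<Gamma> A as (Arr B C) \<Longrightarrow> typF \<Gamma> a B \<Longrightarrow> insts C R \<Longrightarrow> spine \<Gamma> A (as @ [a]) R"
  by (induction A as "Arr B C" rule: spine.induct) (auto intro: spine.intros)

lemma typF_apps_Var: "typF \<Gamma> (apps (Var k) as) A \<Longrightarrow> insts A R \<Longrightarrow> spine \<Gamma> (\<Gamma> ! k) as R"
proof (induction as arbitrary: A R rule: rev_induct)
  case Nil
  then show ?case using typF_Var[of \<Gamma> k A R] by (simp add: spine.Nil)
next
  case (snoc a as)
  from snoc.prems obtain B C where "typF \<Gamma> (apps (Var k) as) (Arr B C)" "typF \<Gamma> a B" "insts C R"
    using typF_App[of \<Gamma> "apps (Var k) as" a A R] by auto
  with snoc.IH[of "Arr B C" "Arr B C"] show ?case by (simp add: spine_snoc)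
qed

lemma spine_typF: "spine \<Gamma> A as R \<Longrightarrow> typF \<Gamma> h A \<Longrightarrow> typF \<Gamma> (apps h as) R"
proof (induction arbitrary: h rule: spine.induct)
  case (Nil A R)
  then show ?case by (simp add: typF_insts)
next
  case (Cons A B C a as R)
  have "typF \<Gamma> (App h a) C"
    using typF_insts[OF Cons.hyps(1) Cons.prems] Cons.hyps(2) by (rule typing.arr_e)
  from Cons.IH[OF this] show ?case by simp
qed

lemma spine_weaken: "spine \<Gamma> A as R \<Longrightarrow> spine (\<Gamma> @ \<Gamma>') A as R"
  by (induction rule: spine.induct) (auto intro: spine.intros typing_weaken)

lemma spine_args_fv: "spine \<Gamma> A as R \<Longrightarrow> a \<in> set as \<Longrightarrow> i \<in> fv a \<Longrightarrow> i < length \<Gamma>"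
  by (induction rule: spine.induct) (auto dest: typing_fv)

lemma spine_Forall:
  assumes "spine \<Gamma> (Forall A) as R"
  obtains C where "proper C" "spine \<Gamma> (tsub (tinst C) A) as R"
  using assms by cases (auto elim!: insts_ForallE intro: spine.intros)

text \<open>\<open>TBot\<close> is not an arrow, so the list cannot end here. This is how typing
  guarantees an argument for every abstraction that reaches the head.\<close>

lemma spine_Arr:
  assumes "spine \<Gamma> (Arr A B) as TBot"
  obtains a as' where "as = a # as'" "typF \<Gamma> a A" "spine \<Gamma> B as' TBot"
  using assms by cases auto

lemma spine_TBot: "spine \<Gamma> TBot as TBot \<Longrightarrow> as = []"
  by (erule spine.cases) (auto elim: insts.cases)

section \<open>The translation of types by negating atoms\<close>

lemma ftv_star [simp]: "ftv (star A) = ftv A"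
  by (induction A) (simp_all add: neg_def ftv.simps(6))

lemma proper_star: "proper A \<Longrightarrow> proper (star A)"
  by (induction A) (simp_all add: neg_def)

text \<open>A renaming sends variables to variables. For \<open>tsub\<close> the analogous equation
  fails, since \<open>star\<close> would also translate the substituted types; hence the types
  \<open>tsub s (star A)\<close> in \<open>closure\<close>.\<close>

lemma star_tren: "star (tren r A) = tren r (star A)"
  by (induction A arbitrary: r) (simp_all add: neg_def)

subsection \<open>Closures\<close>

text \<open>A variable k > 0 of the context stands for an unevaluated closure (u, e) of a subterm u of
  the normal form of t; variable 0 is f.  In the type of a closure the substitution s records the
  instantiation of the quantifiers of D that have been crossed so far.\<close>
definition closure :: "ty list \<Rightarrow> tm \<Rightarrow> tm list \<Rightarrow> ty \<Rightarrow> bool" where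
  "closure \<Gamma> u e B \<longleftrightarrow> (\<exists>\<Delta> A s. typF0 \<Delta> u A \<and> (\<forall>C\<in>set \<Delta>. proper C) \<and> (\<forall>n. proper (s n)) \<and>
     length e = length \<Delta> \<and> (\<forall>i<length \<Delta>. typF \<Gamma> (e ! i) (tsub s (star (\<Delta> ! i)))) \<and>
     B = tsub s (star A))"

text \<open>The environment of entry \<open>k\<close> is typed in \<open>take k \<Gamma>\<close>, so
  it refers to earlier variables only; an induction on indices relies on this. Index 0 is exempt
  because it is f.\<close>

definition closures :: "ty list \<Rightarrow> (tm \<times> tm list) list \<Rightarrow> bool" where
  "closures \<Gamma> cs \<longleftrightarrow> length cs = length \<Gamma> \<and>
     (\<forall>k. 0 < k \<longrightarrow> k < length \<Gamma> \<longrightarrow> closure (take k \<Gamma>) (fst (cs ! k)) (snd (cs ! k)) (\<Gamma> ! k))"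

text \<open>A representative is any \<open>w\<close> with a standard reduction to \<open>u\<close>,
  evaluated in the environment. Since \<open>w\<close> may have free variables that \<open>u\<close>
  lacks, \<open>\<epsilon>\<close> is left unconstrained beyond the environment.\<close>

definition evals :: "(nat \<Rightarrow> tm) \<Rightarrow> tm \<Rightarrow> tm list \<Rightarrow> tm \<Rightarrow> bool" where
  "evals \<sigma> u e r \<longleftrightarrow> (\<exists>w \<epsilon>. st w u \<and> r = sub \<epsilon> w \<and> (\<forall>i<length e. \<epsilon> i = sub \<sigma> (e ! i)))"

definition realizes :: "(nat \<Rightarrow> tm) \<Rightarrow> (tm \<times> tm list) list \<Rightarrow> bool" where
  "realizes \<sigma> cs \<longleftrightarrow> (\<forall>k. 0 < k \<longrightarrow> k < length cs \<longrightarrow> evals \<sigma> (fst (cs ! k)) (snd (cs ! k)) (\<sigma> k))"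

lemma closure_fv: "closure \<Gamma> u e B \<Longrightarrow> x \<in> set e \<Longrightarrow> i \<in> fv x \<Longrightarrow> i < length \<Gamma>"
  by (auto simp: closure_def in_set_conv_nth dest: typing_fv)

lemma sub_agree: "(\<And>i. i \<in> fv t \<Longrightarrow> i < n) \<Longrightarrow> \<forall>k<n. \<sigma>' k = \<sigma> k \<Longrightarrow> sub \<sigma>' t = sub \<sigma> t"
  by (rule sub_cong_fv) simp

lemma evals_agree:
  assumes "\<And>x i. x \<in> set e \<Longrightarrow> i \<in> fv x \<Longrightarrow> i < n" "\<forall>k<n. \<sigma>' k = \<sigma> k" "evals \<sigma> u e r"
  shows "evals \<sigma>' u e r"
proof -
  have "sub \<sigma>' (e ! i) = sub \<sigma> (e ! i)" if "i < length e" for i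
    using assms(1)[of "e ! i"] that by (intro sub_agree[OF _ assms(2)]) simp
  with assms(3) show ?thesis by (auto simp: evals_def)
qed

lemma closures_snoc:
  assumes "closures \<Gamma> cs" "closure \<Gamma> u e B"
  shows "closures (\<Gamma> @ [B]) (cs @ [(u, e)])"
  using assms by (auto simp: closures_def nth_append less_Suc_eq)

text \<open>Earlier closures mention only earlier variables, so giving a value to the new one does
  not disturb them.\<close>

lemma realizes_snoc:
  assumes "closures \<Gamma> cs" "closure \<Gamma> u e B" "realizes \<sigma> cs" "evals \<sigma> u e r"
  shows "realizes (\<sigma>(length \<Gamma> := r)) (cs @ [(u, e)])"
proof -
  let ?\<sigma> = "\<sigma>(length \<Gamma> := r)"
  have len: "length cs = length \<Gamma>" using assms(1) by (simp add: closures_def)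
  have "evals ?\<sigma> (fst (cs ! k)) (snd (cs ! k)) (\<sigma> k)" if k: "0 < k" "k < length \<Gamma>" for k
  proof (rule evals_agree)
    have "closure (take k \<Gamma>) (fst (cs ! k)) (snd (cs ! k)) (\<Gamma> ! k)"
      using assms(1) k by (simp add: closures_def)
    from closure_fv[OF this] show "i < k" if "x \<in> set (snd (cs ! k))" "i \<in> fv x" for x i
      using that by fastforce
    show "\<forall>j<k. ?\<sigma> j = \<sigma> j" using k by simp
    show "evals \<sigma> (fst (cs ! k)) (snd (cs ! k)) (\<sigma> k)" using assms(3) k len by (simp add: realizes_def)
  qed
  moreover have "evals ?\<sigma> u e r"
    by (rule evals_agree[OF closure_fv[OF assms(2)] _ assms(4)]) auto
  ultimately show ?thesis using len by (auto simp: realizes_def nth_append less_Suc_eq)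
qed

lemma map_sub_agree:
  "(\<And>a i. a \<in> set as \<Longrightarrow> i \<in> fv a \<Longrightarrow> i < n) \<Longrightarrow> \<forall>k<n. \<sigma>' k = \<sigma> k \<Longrightarrow>
    map (sub \<sigma>') as = map (sub \<sigma>) as"
  by (rule map_cong[OF refl]) (blast intro: sub_agree)

text \<open>Running a closure in head position until a component of its environment reaches the head.
  The flag p records that a genuine weak head step was made; all data but the substitutions are
  independent of the term represented by the closure.\<close>
lemma run_closure:
  "typing b \<Delta> u A \<Longrightarrow> \<not> b \<Longrightarrow> \<forall>C\<in>set \<Delta>. proper C \<Longrightarrow> (\<And>n. proper (s n)) \<Longrightarrow>
    length e = length \<Delta> \<Longrightarrow> (\<And>i. i < length \<Delta> \<Longrightarrow> typF \<Gamma> (e ! i) (tsub s (star (\<Delta> ! i)))) \<Longrightarrow>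
    closures \<Gamma> cs \<Longrightarrow> spine \<Gamma> (tsub s (star A)) as TBot \<Longrightarrow>
    \<exists>\<Gamma>' cs' h as' p. closures (\<Gamma> @ \<Gamma>') (cs @ cs') \<and> typF (\<Gamma> @ \<Gamma>') (apps h as') TBot \<and>
      (p \<or> h \<in> set e) \<and>
      (\<forall>\<sigma> w \<epsilon>. realizes \<sigma> cs \<longrightarrow> st w u \<longrightarrow> (\<forall>i<length e. \<epsilon> i = sub \<sigma> (e ! i)) \<longrightarrow>
        (\<exists>\<sigma>'. (\<forall>k<length \<Gamma>. \<sigma>' k = \<sigma> k) \<and> realizes \<sigma>' (cs @ cs') \<and>
          (if p then whr1\<^sup>+\<^sup>+ else whr) (apps (sub \<epsilon> w) (map (sub \<sigma>) as)) (sub \<sigma>' (apps h as'))))"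
proof (induction arbitrary: s e \<Gamma> cs as rule: typing.induct)
  case (ax i \<Delta> b)
  have i: "i < length e" using ax by simp
  have "typF \<Gamma> (apps (e ! i) as) TBot"
    by (rule spine_typF) (use ax in auto)
  moreover have "whr (apps (sub \<epsilon> w) (map (sub \<sigma>) as)) (sub \<sigma> (apps (e ! i) as))"
    if "st w (Var i)" "\<forall>i<length e. \<epsilon> i = sub \<sigma> (e ! i)" for \<sigma> w \<epsilon>
  proof -
    from that(1) have "whr w (Var i)" by (rule st_VarE)
    then have "whr (sub \<epsilon> w) (sub \<sigma> (e ! i))" using whr_sub[of w "Var i" \<epsilon>] that(2) i by simp
    then show ?thesis by (simp add: sub_apps whr_apps)
  qed
  \<comment> \<open>The flag is \<open>False\<close> because \<open>w\<close> may already be the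
    variable; in exchange the new head is a component of \<open>e\<close>.\<close>
  ultimately show ?case using ax.prems(6) i
    by (intro exI[of _ "[]"] exI[of _ "e ! i"] exI[of _ as] exI[of _ False]) auto
next
  case (arr_i B b \<Delta> t C)
  from arr_i.prems(7) obtain a as1 where as: "as = a # as1"
    and a: "typF \<Gamma> a (tsub s (star B))" and sp: "spine \<Gamma> (tsub s (star C)) as1 TBot"
    by (auto elim: spine_Arr)
  have 1: "\<forall>C\<in>set (B # \<Delta>). proper C" using arr_i by simp
  have 2: "length (a # e) = length (B # \<Delta>)" using arr_i by simp
  have 3: "typF \<Gamma> ((a # e) ! i) (tsub s (star ((B # \<Delta>) ! i)))" if "i < length (B # \<Delta>)" for i
    using a arr_i.prems(5) that by (cases i) simp_all
  obtain \<Gamma>' cs' h as' p where *: "closures (\<Gamma> @ \<Gamma>') (cs @ cs')" "typF (\<Gamma> @ \<Gamma>') (apps h as') TBot"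
    and run: "\<And>\<sigma> w \<epsilon>. realizes \<sigma> cs \<Longrightarrow> st w t \<Longrightarrow> \<forall>i<length (a # e). \<epsilon> i = sub \<sigma> ((a # e) ! i) \<Longrightarrow>
        \<exists>\<sigma>'. (\<forall>k<length \<Gamma>. \<sigma>' k = \<sigma> k) \<and> realizes \<sigma>' (cs @ cs') \<and>
          (if p then whr1\<^sup>+\<^sup>+ else whr) (apps (sub \<epsilon> w) (map (sub \<sigma>) as1)) (sub \<sigma>' (apps h as'))"
    using arr_i.IH[OF arr_i.prems(1) 1 arr_i.prems(3) 2 3 arr_i.prems(6) sp] by blast
  have "\<exists>\<sigma>'. (\<forall>k<length \<Gamma>. \<sigma>' k = \<sigma> k) \<and> realizes \<sigma>' (cs @ cs') \<and>
      whr1\<^sup>+\<^sup>+ (apps (sub \<epsilon> w) (map (sub \<sigma>) as)) (sub \<sigma>' (apps h as'))"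
    if real: "realizes \<sigma> cs" and w: "st w (Lam t)" and \<epsilon>: "\<forall>i<length e. \<epsilon> i = sub \<sigma> (e ! i)" for \<sigma> w \<epsilon>
  proof -
    from w obtain w' where w': "whr w (Lam w')" "st w' t" by (rule st_LamE)
    have "\<forall>i<length (a # e). case_nat (sub \<sigma> a) \<epsilon> i = sub \<sigma> ((a # e) ! i)"
      using \<epsilon> by (auto split: nat.split)
    from run[OF real w'(2) this] obtain \<sigma>' where \<sigma>': "\<forall>k<length \<Gamma>. \<sigma>' k = \<sigma> k" "realizes \<sigma>' (cs @ cs')"
      "(if p then whr1\<^sup>+\<^sup>+ else whr) (apps (sub (case_nat (sub \<sigma> a) \<epsilon>) w') (map (sub \<sigma>) as1)) (sub \<sigma>' (apps h as'))"
      by blast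
    have "whr (apps (sub (case_nat (sub \<sigma> a) \<epsilon>) w') (map (sub \<sigma>) as1)) (sub \<sigma>' (apps h as'))"
      using \<sigma>'(3) by (auto simp: whr_def split: if_splits)
    moreover have "whr (apps (sub \<epsilon> w) (map (sub \<sigma>) as)) (apps (App (Lam (sub (ups \<epsilon>) w')) (sub \<sigma> a)) (map (sub \<sigma>) as1))"
      using whr_apps[OF whr_sub[OF w'(1), of \<epsilon>], of "map (sub \<sigma>) as"] by (simp add: as)
    moreover have "whr1 (apps (App (Lam (sub (ups \<epsilon>) w')) (sub \<sigma> a)) (map (sub \<sigma>) as1))
        (apps (sub (case_nat (sub \<sigma> a) \<epsilon>) w') (map (sub \<sigma>) as1))"
      by (rule whr1_apps) (metis whr1.head sub_inst_ups)
    ultimately have "whr1\<^sup>+\<^sup>+ (apps (sub \<epsilon> w) (map (sub \<sigma>) as)) (sub \<sigma>' (apps h as'))"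
      unfolding whr_def by (metis rtranclp_into_tranclp1 tranclp_rtranclp_tranclp)
    with \<sigma>' show ?thesis by blast
  qed
  \<comment> \<open>The redex formed by the abstraction and its argument is contracted whatever the
    inner flag says. With \<open>True\<close> the head need not lie in \<open>e\<close>, and indeed
    it may be the argument \<open>a\<close>.\<close>
  with * show ?case
    by (intro exI[of _ \<Gamma>'] exI[of _ cs'] exI[of _ h] exI[of _ as'] exI[of _ True]) simp
next
  case (arr_e b \<Delta> u B C v)
  \<comment> \<open>The argument \<open>v\<close> is not evaluated: the fresh variable
    \<open>length \<Gamma>\<close> is allocated for the closure \<open>(v, e)\<close> and pushed
    onto the arguments.\<close>
  define \<Gamma>1 where "\<Gamma>1 = \<Gamma> @ [tsub s (star B)]"
  define cs1 where "cs1 = cs @ [(v, e)]"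
  define as1 where "as1 = Var (length \<Gamma>) # as"
  have len: "length cs = length \<Gamma>" using arr_e.prems(6) by (simp add: closures_def)
  have clo: "closure \<Gamma> v e (tsub s (star B))"
    unfolding closure_def using arr_e.hyps(2) arr_e.prems(1-5) by (intro exI[of _ \<Delta>] exI[of _ B] exI[of _ s]) simp
  have cl1: "closures \<Gamma>1 cs1"
    unfolding \<Gamma>1_def cs1_def by (rule closures_snoc[OF arr_e.prems(6) clo])
  have e1: "typF \<Gamma>1 (e ! i) (tsub s (star (\<Delta> ! i)))" if "i < length \<Delta>" for i
    unfolding \<Gamma>1_def by (rule typing_weaken[OF arr_e.prems(5)[OF that]])
  have "typF \<Gamma>1 (Var (length \<Gamma>)) (tsub s (star B))"
    using typing.ax[of "length \<Gamma>" \<Gamma>1 True] by (simp add: \<Gamma>1_def)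
  then have sp1: "spine \<Gamma>1 (tsub s (star (Arr B C))) as1 TBot"
    unfolding as1_def \<Gamma>1_def using spine_weaken[OF arr_e.prems(7)] by (auto intro: spine.Cons)
  from arr_e.IH(1)[OF arr_e.prems(1-4) e1 cl1 sp1]
  obtain \<Gamma>' cs' h as' p where *: "closures (\<Gamma>1 @ \<Gamma>') (cs1 @ cs')" "typF (\<Gamma>1 @ \<Gamma>') (apps h as') TBot"
    "p \<or> h \<in> set e"
    and run: "\<And>\<sigma> w \<epsilon>. realizes \<sigma> cs1 \<Longrightarrow> st w u \<Longrightarrow> \<forall>i<length e. \<epsilon> i = sub \<sigma> (e ! i) \<Longrightarrow>
        \<exists>\<sigma>'. (\<forall>k<length \<Gamma>1. \<sigma>' k = \<sigma> k) \<and> realizes \<sigma>' (cs1 @ cs') \<and>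
          (if p then whr1\<^sup>+\<^sup>+ else whr) (apps (sub \<epsilon> w) (map (sub \<sigma>) as1)) (sub \<sigma>' (apps h as'))"
    by blast
  have "\<exists>\<sigma>'. (\<forall>k<length \<Gamma>. \<sigma>' k = \<sigma> k) \<and> realizes \<sigma>' (cs1 @ cs') \<and>
      (if p then whr1\<^sup>+\<^sup>+ else whr) (apps (sub \<epsilon> w) (map (sub \<sigma>) as)) (sub \<sigma>' (apps h as'))"
    if real: "realizes \<sigma> cs" and w: "st w (App u v)" and \<epsilon>: "\<forall>i<length e. \<epsilon> i = sub \<sigma> (e ! i)" for \<sigma> w \<epsilon>
  proof -
    \<comment> \<open>The representative need not be an application, but it weak head reduces to one
      whose parts represent \<open>u\<close> and \<open>v\<close>.\<close>
    from w obtain w1 w2 where w': "whr w (App w1 w2)" "st w1 u" "st w2 v" by (rule st_AppE)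
    define \<sigma>1 where "\<sigma>1 = \<sigma>(length \<Gamma> := sub \<epsilon> w2)"
    have agree: "\<forall>k<length \<Gamma>. \<sigma>1 k = \<sigma> k" by (simp add: \<sigma>1_def)
    have "evals \<sigma> v e (sub \<epsilon> w2)" using w'(3) \<epsilon> by (auto simp: evals_def)
    then have real1: "realizes \<sigma>1 cs1"
      unfolding \<sigma>1_def cs1_def by (rule realizes_snoc[OF arr_e.prems(6) clo real])
    have "sub \<sigma>1 (e ! i) = sub \<sigma> (e ! i)" if "i < length e" for i
      using closure_fv[OF clo, of "e ! i"] that by (intro sub_agree[OF _ agree]) simp
    with \<epsilon> have "\<forall>i<length e. \<epsilon> i = sub \<sigma>1 (e ! i)" by simp
    from run[OF real1 w'(2) this] obtain \<sigma>' where \<sigma>': "\<forall>k<length \<Gamma>1. \<sigma>' k = \<sigma>1 k"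
      "realizes \<sigma>' (cs1 @ cs')"
      "(if p then whr1\<^sup>+\<^sup>+ else whr) (apps (sub \<epsilon> w1) (map (sub \<sigma>1) as1)) (sub \<sigma>' (apps h as'))"
      by blast
    have as: "map (sub \<sigma>1) as = map (sub \<sigma>) as"
      by (rule map_sub_agree[OF _ agree]) (rule spine_args_fv[OF arr_e.prems(7)])
    have "\<sigma>1 (length \<Gamma>) = sub \<epsilon> w2" by (simp add: \<sigma>1_def)
    then have "apps (sub \<epsilon> w1) (map (sub \<sigma>1) as1) = apps (sub \<epsilon> (App w1 w2)) (map (sub \<sigma>) as)"
      unfolding as1_def list.map(2) as by simp
    with whr_apps[OF whr_sub[OF w'(1), of \<epsilon>], of "map (sub \<sigma>) as"]
    have "whr (apps (sub \<epsilon> w) (map (sub \<sigma>) as)) (apps (sub \<epsilon> w1) (map (sub \<sigma>1) as1))" by simp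
    with \<sigma>'(3) have "(if p then whr1\<^sup>+\<^sup>+ else whr) (apps (sub \<epsilon> w) (map (sub \<sigma>) as)) (sub \<sigma>' (apps h as'))"
      unfolding whr_def by (simp split: if_splits)
    moreover have "\<forall>k<length \<Gamma>. \<sigma>' k = \<sigma> k" using \<sigma>'(1) agree by (simp add: \<Gamma>1_def)
    ultimately show ?thesis using \<sigma>'(2) by blast
  qed
  with * show ?case
    by (intro exI[of _ "tsub s (star B) # \<Gamma>'"] exI[of _ "(v, e) # cs'"] exI[of _ h] exI[of _ as'] exI[of _ p])
      (simp add: \<Gamma>1_def cs1_def)
next
  case (all_i b \<Delta> t A)
  \<comment> \<open>The instance that the spine selects is recorded in the substitution, leaving the
    F0 derivation intact.\<close>
  from all_i.prems(7) obtain C where C: "proper C" "spine \<Gamma> (tsub (case_nat C s) (star A)) as TBot"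
    by (auto elim: spine_Forall simp: tsub_tinst_tups)
  have 1: "\<forall>C\<in>set (map (tren Suc) \<Delta>). proper C" using all_i.prems(2) by (simp add: proper_tren)
  have 2: "proper (case_nat C s n)" for n by (rule proper_case_nat[OF C(1) all_i.prems(3)])
  have 3: "length e = length (map (tren Suc) \<Delta>)" using all_i.prems(4) by simp
  have 4: "typF \<Gamma> (e ! i) (tsub (case_nat C s) (star (map (tren Suc) \<Delta> ! i)))"
    if "i < length (map (tren Suc) \<Delta>)" for i
    using all_i.prems(5)[of i] that by (simp add: star_tren tsub_case_nat_tren)
  from all_i.IH[OF all_i.prems(1) 1 2 3 4 all_i.prems(6) C(2)] show ?case .
next
  \<comment> \<open>Excluded by \<open>\<not> b\<close>. An instantiation inside the derivation
    would require \<open>star\<close> to commute with substitution.\<close>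
  case (all_e b \<Delta> t A C)
  then show ?case by simp
qed

text \<open>\<open>\<tau>\<close> and the extension of the context are chosen before
  \<open>\<sigma>\<close>: one stored term serves all realizers, and only the final substitution
  varies.\<close>

definition stores :: "ty \<Rightarrow> ty list \<Rightarrow> (tm \<times> tm list) list \<Rightarrow> tm \<Rightarrow> bool" where
  "stores D \<Gamma> cs M \<longleftrightarrow> (\<exists>\<Gamma>' cs' \<tau>. closures (\<Gamma> @ \<Gamma>') (cs @ cs') \<and> typF (\<Gamma> @ \<Gamma>') \<tau> D \<and>
     (\<forall>\<sigma>. realizes \<sigma> cs \<longrightarrow> (\<exists>\<sigma>'. (\<forall>k<length \<Gamma>. \<sigma>' k = \<sigma> k) \<and>
       whr (sub \<sigma> M) (App (\<sigma> 0) (sub \<sigma>' \<tau>)))))"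

text \<open>Prefixes a run by reductions that may allocate new closures. Agreement of the
  substitutions on the nonempty \<open>\<Gamma>\<close> keeps the value of f fixed.\<close>

lemma stores_step:
  assumes "\<Gamma> \<noteq> []" "stores D (\<Gamma> @ \<Gamma>1) (cs @ cs1) M'"
    and "\<And>\<sigma>. realizes \<sigma> cs \<Longrightarrow>
      \<exists>\<sigma>'. (\<forall>k<length \<Gamma>. \<sigma>' k = \<sigma> k) \<and> realizes \<sigma>' (cs @ cs1) \<and> whr (sub \<sigma> M) (sub \<sigma>' M')"
  shows "stores D \<Gamma> cs M"
proof -
  from assms(2) obtain \<Gamma>' cs' \<tau> where *: "closures (\<Gamma> @ \<Gamma>1 @ \<Gamma>') (cs @ cs1 @ cs')"
    "typF (\<Gamma> @ \<Gamma>1 @ \<Gamma>') \<tau> D"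
    and run: "\<And>\<sigma>. realizes \<sigma> (cs @ cs1) \<Longrightarrow> \<exists>\<sigma>'. (\<forall>k<length (\<Gamma> @ \<Gamma>1). \<sigma>' k = \<sigma> k) \<and>
       whr (sub \<sigma> M') (App (\<sigma> 0) (sub \<sigma>' \<tau>))"
    by (auto simp: stores_def)
  have "\<exists>\<sigma>'. (\<forall>k<length \<Gamma>. \<sigma>' k = \<sigma> k) \<and> whr (sub \<sigma> M) (App (\<sigma> 0) (sub \<sigma>' \<tau>))"
    if real: "realizes \<sigma> cs" for \<sigma>
  proof -
    from assms(3)[OF real] obtain \<sigma>1 where 1: "\<forall>k<length \<Gamma>. \<sigma>1 k = \<sigma> k" "realizes \<sigma>1 (cs @ cs1)"
      "whr (sub \<sigma> M) (sub \<sigma>1 M')" by blast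
    from run[OF 1(2)] obtain \<sigma>2 where 2: "\<forall>k<length (\<Gamma> @ \<Gamma>1). \<sigma>2 k = \<sigma>1 k"
      "whr (sub \<sigma>1 M') (App (\<sigma>1 0) (sub \<sigma>2 \<tau>))" by blast
    have "\<sigma>1 0 = \<sigma> 0" using 1(1) assms(1) by simp
    with 1 2 whr_trans[OF 1(3) 2(2)] show ?thesis by (intro exI[of _ \<sigma>2]) simp
  qed
  with * show ?thesis unfolding stores_def by (intro exI[of _ "\<Gamma>1 @ \<Gamma>'"] exI[of _ "cs1 @ cs'"] exI[of _ \<tau>]) simp
qed

lemma not_typF_Lam_TBot: "\<not> typF \<Gamma> (Lam t) TBot"
  using typF_Lam[of \<Gamma> t TBot TBot] insts_TBot by auto

text \<open>Two nested inductions: on termination of weak head reduction from \<open>R\<close>, and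
  on the index of the head variable. Termination is needed for one realizer only, since the course
  of the run is the same for all. Asking that \<open>R\<close> reduce to
  \<open>sub \<sigma> M\<close>, instead of being equal to it, covers the moves of the run that
  reduce nothing.\<close>

lemma stores_terminating:
  "Wellfounded.accp whr1\<inverse>\<inverse> R \<Longrightarrow> whr R (sub \<sigma> M) \<Longrightarrow> closures \<Gamma> cs \<Longrightarrow> \<Gamma> \<noteq> [] \<Longrightarrow>
    \<Gamma> ! 0 = neg D \<Longrightarrow> typF \<Gamma> M TBot \<Longrightarrow> realizes \<sigma> cs \<Longrightarrow> stores D \<Gamma> cs M"
proof (induction R arbitrary: \<sigma> M \<Gamma> cs rule: accp.induct)
  case (accI R)
  \<comment> \<open>As soon as a step from \<open>R\<close> has been made, the outer induction
    hypothesis applies to its reduct.\<close>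
  have outer: "stores D \<Gamma> cs M" if "whr1\<^sup>+\<^sup>+ R (sub \<sigma> M)" "closures \<Gamma> cs" "\<Gamma> \<noteq> []" "\<Gamma> ! 0 = neg D"
    "typF \<Gamma> M TBot" "realizes \<sigma> cs" for \<sigma> M \<Gamma> cs
  proof -
    from that(1) obtain R1 where "whr1 R R1" "whr R1 (sub \<sigma> M)" unfolding whr_def by (metis tranclpD)
    then show ?thesis by (intro accI.IH[OF _ _ that(2-6)]) simp_all
  qed
  have reducible: "stores D \<Gamma> cs M" if "whr R (sub \<sigma> M)" "closures \<Gamma> cs" "\<Gamma> \<noteq> []" "\<Gamma> ! 0 = neg D"
    "typF \<Gamma> M TBot" "realizes \<sigma> cs" "whr1 M M'" for \<sigma> M M' \<Gamma> cs
  proof (rule stores_step[where ?\<Gamma>1.0 = "[]" and ?cs1.0 = "[]" and M' = M'])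
    have "whr1\<^sup>+\<^sup>+ R (sub \<sigma> M')"
      using that(1) whr1_sub[OF that(7), of \<sigma>] unfolding whr_def by (rule rtranclp_into_tranclp1)
    moreover have "typF \<Gamma> M' TBot"
      using subject_reduction_step[OF that(5) _ whr1_beta[OF that(7)]] by simp
    ultimately show "stores D (\<Gamma> @ []) (cs @ []) M'" using outer that(2-6) by simp
    show "\<exists>\<sigma>'. (\<forall>k<length \<Gamma>. \<sigma>' k = \<sigma> k) \<and> realizes \<sigma>' (cs @ []) \<and> whr (sub \<sigma> M) (sub \<sigma>' M')"
      if "realizes \<sigma> cs" for \<sigma>
      using that whr1_whr[OF whr1_sub[OF \<open>whr1 M M'\<close>]] by auto
  qed (rule that)
  have variable: "stores D \<Gamma> cs (apps (Var k) as)" if "whr R (sub \<sigma> (apps (Var k) as))" "closures \<Gamma> cs" "\<Gamma> \<noteq> []"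
    "\<Gamma> ! 0 = neg D" "typF \<Gamma> (apps (Var k) as) TBot" "realizes \<sigma> cs" for k as \<sigma> \<Gamma> cs
    using that
  proof (induction k arbitrary: as \<sigma> \<Gamma> cs rule: less_induct)
    case (less k)
    have sp: "spine \<Gamma> (\<Gamma> ! k) as TBot" by (rule typF_apps_Var[OF less.prems(5) insts_TBot])
    have k: "k < length \<Gamma>" by (rule typing_fv[OF less.prems(5)]) (simp add: fv_apps_head)
    show ?case
    proof (cases "k = 0")
      case True
      \<comment> \<open>Here f is in head position; the type \<open>neg D\<close> and the result
        \<open>TBot\<close> force exactly one argument, which is the term to be stored.\<close>
      with sp less.prems(4) obtain a where "as = [a]" "typF \<Gamma> a D"
        by (auto simp: neg_def elim!: spine_Arr dest: spine_TBot)
      with True less.prems show ?thesis unfolding stores_def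
        by (intro exI[of _ "[]"] exI[of _ a]) auto
    next
      case False
      obtain u e where ue: "cs ! k = (u, e)" by (cases "cs ! k")
      have "closure (take k \<Gamma>) (fst (cs ! k)) (snd (cs ! k)) (\<Gamma> ! k)"
        using less.prems(2) False k unfolding closures_def by blast
      then have clo: "closure (take k \<Gamma>) u e (\<Gamma> ! k)" by (simp add: ue)
      then obtain \<Delta> A s where A: "typF0 \<Delta> u A" "\<forall>C\<in>set \<Delta>. proper C" "\<And>n. proper (s n)"
        "length e = length \<Delta>" "\<And>i. i < length \<Delta> \<Longrightarrow> typF (take k \<Gamma>) (e ! i) (tsub s (star (\<Delta> ! i)))"
        "\<Gamma> ! k = tsub s (star A)"
        unfolding closure_def by blast
      have e: "typF \<Gamma> (e ! i) (tsub s (star (\<Delta> ! i)))" if "i < length \<Delta>" for i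
        using typing_weaken[OF A(5)[OF that], of "drop k \<Gamma>"] by simp
      from run_closure[OF A(1) notI A(2-4) e less.prems(2) sp[unfolded A(6)]]
      obtain \<Gamma>' cs' h as' p where M': "closures (\<Gamma> @ \<Gamma>') (cs @ cs')" "typF (\<Gamma> @ \<Gamma>') (apps h as') TBot"
        "p \<or> h \<in> set e"
        and run: "\<And>\<sigma> w \<epsilon>. realizes \<sigma> cs \<Longrightarrow> st w u \<Longrightarrow> \<forall>i<length e. \<epsilon> i = sub \<sigma> (e ! i) \<Longrightarrow>
          \<exists>\<sigma>'. (\<forall>k<length \<Gamma>. \<sigma>' k = \<sigma> k) \<and> realizes \<sigma>' (cs @ cs') \<and>
          (if p then whr1\<^sup>+\<^sup>+ else whr) (apps (sub \<epsilon> w) (map (sub \<sigma>) as)) (sub \<sigma>' (apps h as'))"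
        by blast
      have run': "\<exists>\<sigma>'. (\<forall>k<length \<Gamma>. \<sigma>' k = \<sigma> k) \<and> realizes \<sigma>' (cs @ cs') \<and>
          (if p then whr1\<^sup>+\<^sup>+ else whr) (sub \<sigma> (apps (Var k) as)) (sub \<sigma>' (apps h as'))"
        if "realizes \<sigma> cs" for \<sigma>
      proof -
        have "k < length cs" using less.prems(2) k by (simp add: closures_def)
        with that False have "evals \<sigma> (fst (cs ! k)) (snd (cs ! k)) (\<sigma> k)"
          unfolding realizes_def by blast
        then have "evals \<sigma> u e (\<sigma> k)" by (simp add: ue)
        then obtain w \<epsilon> where "st w u" "\<sigma> k = sub \<epsilon> w" "\<forall>i<length e. \<epsilon> i = sub \<sigma> (e ! i)"
          by (auto simp: evals_def)
        with run[OF that this(1,3)] show ?thesis by (simp add: sub_apps)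
      qed
      have ne: "\<Gamma> @ \<Gamma>' \<noteq> []" "(\<Gamma> @ \<Gamma>') ! 0 = neg D" using less.prems(3,4) by (simp_all add: nth_append)
      have whr_if: "(if p then whr1\<^sup>+\<^sup>+ else whr) x y \<Longrightarrow> whr x y" for x y
        by (auto simp: whr_def split: if_splits)
      from run'[OF less.prems(6)] obtain \<sigma>' where \<sigma>': "realizes \<sigma>' (cs @ cs')"
        "(if p then whr1\<^sup>+\<^sup>+ else whr) (sub \<sigma> (apps (Var k) as)) (sub \<sigma>' (apps h as'))" by blast
      have R: "whr R (sub \<sigma>' (apps h as'))" by (rule whr_trans[OF less.prems(1) whr_if[OF \<sigma>'(2)]])
      have "stores D (\<Gamma> @ \<Gamma>') (cs @ cs') (apps h as')"
      \<comment> \<open>Either a head step was made, or the head is a component of the environment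
        of variable \<open>k\<close>. Such a component reduces, or is an abstraction that meets an
        argument, or is headed by a variable below \<open>k\<close>.\<close>
      proof (cases p)
        case True
        with \<sigma>'(2) less.prems(1) have "whr1\<^sup>+\<^sup>+ R (sub \<sigma>' (apps h as'))"
          unfolding whr_def by simp
        then show ?thesis by (rule outer[OF _ M'(1) ne M'(2) \<sigma>'(1)])
      next
        case False
        with M'(3) have h: "h \<in> set e" by simp
        show ?thesis
        proof (cases h rule: whr_head_cases)
          case (step h')
          show ?thesis by (rule reducible[OF R M'(1) ne M'(2) \<sigma>'(1) whr1_apps[OF step]])
        next
          case (Lam t)
          show ?thesis
          proof (cases as')
            case Nil
            with M'(2) Lam show ?thesis by (simp add: not_typF_Lam_TBot)
          next
            case (Cons a as'')
            with Lam have "whr1 (apps h as') (apps (sub (inst a) t) as'')"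
              by (simp add: whr1_apps whr1.head)
            then show ?thesis by (rule reducible[OF R M'(1) ne M'(2) \<sigma>'(1)])
          qed
        next
          case (Var k' bs)
          then have "k' \<in> fv h" by (simp add: fv_apps_head)
          from closure_fv[OF clo h this] have k': "k' < k" by simp
          have eq: "apps h as' = apps (Var k') (bs @ as')" using Var by simp
          show ?thesis unfolding eq
            by (rule less.IH[OF k' R[unfolded eq] M'(1) ne M'(2)[unfolded eq] \<sigma>'(1)])
        qed
      qed
      then show ?thesis
      proof (rule stores_step[OF less.prems(3)])
        show "\<exists>\<sigma>'. (\<forall>k<length \<Gamma>. \<sigma>' k = \<sigma> k) \<and> realizes \<sigma>' (cs @ cs') \<and>
          whr (sub \<sigma> (apps (Var k) as)) (sub \<sigma>' (apps h as'))" if "realizes \<sigma> cs" for \<sigma>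
          using run'[OF that] whr_if by blast
      qed
    qed
  qed
  show ?case
  proof (cases M rule: whr_head_cases)
    case (step M')
    then show ?thesis by (rule reducible[OF accI.prems])
  next
    case (Lam t)
    with accI.prems(5) show ?thesis by (simp add: not_typF_Lam_TBot)
  next
    case (Var k as)
    with accI.prems show ?thesis by (simp add: variable)
  qed
qed

subsection \<open>Extraction of the closed value\<close>

text \<open>The output property speaks of \<alpha> : O, whereas the types of f and of the closures
  end in \<bottom>.\<close>

fun bot_to_O :: "ty \<Rightarrow> ty" where
  "bot_to_O (TV n) = TV n"
| "bot_to_O TO = TO"
| "bot_to_O TBot = TO"
| "bot_to_O (TC c) = TC c"
| "bot_to_O (Arr A B) = Arr (bot_to_O A) (bot_to_O B)"
| "bot_to_O (Forall A) = Forall (bot_to_O A)"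

lemma bot_to_O_id: "\<not> has_Bot A \<Longrightarrow> bot_to_O A = A"
  by (induction A) simp_all

lemma ftv_bot_to_O [simp]: "ftv (bot_to_O A) = ftv A"
  by (induction A) (simp_all add: ftv.simps(6))

lemma proper_bot_to_O: "proper A \<Longrightarrow> proper (bot_to_O A)"
  by (induction A) simp_all

lemma bot_to_O_tren: "bot_to_O (tren r A) = tren r (bot_to_O A)"
  by (induction A arbitrary: r) simp_all

lemma bot_to_O_tsub: "bot_to_O (tsub s A) = tsub (\<lambda>n. bot_to_O (s n)) (bot_to_O A)"
proof (induction A arbitrary: s)
  case (Forall A)
  have "(\<lambda>n. bot_to_O (tups s n)) = tups (\<lambda>n. bot_to_O (s n))"
    by (rule ext) (simp add: tups_def bot_to_O_tren split: nat.split)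
  with Forall show ?case by simp
qed simp_all

lemma bot_to_O_tinst: "bot_to_O (tsub (tinst C) A) = tsub (tinst (bot_to_O C)) (bot_to_O A)"
proof -
  have "(\<lambda>n. bot_to_O (tinst C n)) = tinst (bot_to_O C)"
    by (rule ext) (simp add: tinst_def split: nat.split)
  then show ?thesis by (simp add: bot_to_O_tsub)
qed

lemma typing_bot_to_O: "typing e \<Gamma> t A \<Longrightarrow> typing e (map bot_to_O \<Gamma>) t (bot_to_O A)"
proof (induction rule: typing.induct)
  case (ax i \<Gamma> e)
  then show ?case using typing.ax[of i "map bot_to_O \<Gamma>" e] by simp
next
  case (all_i e \<Gamma> t A)
  have "map bot_to_O (map (tren Suc) \<Gamma>) = map (tren Suc) (map bot_to_O \<Gamma>)"
    by (simp add: bot_to_O_tren)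
  with all_i.IH have "typing e (map (tren Suc) (map bot_to_O \<Gamma>)) t (bot_to_O A)" by (simp only:)
  with all_i.hyps(2) show ?case by (simp add: typing.all_i)
next
  case (all_e e \<Gamma> t A C)
  then show ?case by (simp add: bot_to_O_tinst typing.all_e proper_bot_to_O)
qed (auto intro: typing.intros proper_bot_to_O)

section \<open>Constant functions and the traces they leave in normal forms\<close>

inductive konst :: "nat \<Rightarrow> tm \<Rightarrow> bool" where
  Var: "konst a (Var a)"
| Lam: "konst (Suc a) c \<Longrightarrow> konst a (Lam c)"

inductive_cases konst_LamE: "konst a (Lam c)"
lemma konst_normal: "konst a c \<Longrightarrow> normal c \<and> a \<in> fv c"
  by (induction rule: konst.induct) simp_all

lemma konst_ren: "konst a c \<Longrightarrow> konst (r a) (ren r c)"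
proof (induction arbitrary: r rule: konst.induct)
  case (Lam a c)
  from Lam.IH[of "upr r"] show ?case by (simp add: konst.Lam)
qed (simp add: konst.Var)

lemma konst_sub: "konst a c \<Longrightarrow> \<sigma> a = Var b \<Longrightarrow> konst b (sub \<sigma> c)"
proof (induction arbitrary: \<sigma> b rule: konst.induct)
  case (Lam a c)
  then show ?case using Lam.IH[of "ups \<sigma>" "Suc b"] by (simp add: konst.Lam)
qed (simp add: konst.Var)

lemma konst_Arr_TO:
  assumes "proper B" "i < length \<Gamma>" "\<Gamma> ! i = TO"
  shows "\<exists>c. konst i c \<and> typF \<Gamma> c (Arr B TO)"
proof (intro exI conjI)
  show "konst i (Lam (Var (Suc i)))" by (intro konst.intros)
  show "typF \<Gamma> (Lam (Var (Suc i))) (Arr B TO)"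
    using typing.ax[of "Suc i" "B # \<Gamma>" True] assms by (simp add: typing.arr_i)
qed

text \<open>Each atom of \<open>A\<close> is negated in \<open>star A\<close>, so the rightmost end
  of the type is \<bottom>, turned into O. The substitution \<open>s\<close> affects only what
  stands to the left of it, hence arbitrary types are harmless there.\<close>

lemma konst_star:
  "proper A \<Longrightarrow> (\<And>n. proper (s n)) \<Longrightarrow> i < length \<Gamma> \<Longrightarrow> \<Gamma> ! i = TO \<Longrightarrow>
    \<exists>c. konst i c \<and> typF \<Gamma> c (bot_to_O (tsub s (star A)))"
proof (induction A arbitrary: s i \<Gamma>)
  case (Arr A B)
  let ?A = "bot_to_O (tsub s (star A))"
  have "\<exists>c. konst (Suc i) c \<and> typF (?A # \<Gamma>) c (bot_to_O (tsub s (star B)))"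
    by (rule Arr.IH(2)) (use Arr.prems in auto)
  then obtain c where "konst (Suc i) c" "typF (?A # \<Gamma>) c (bot_to_O (tsub s (star B)))" by blast
  moreover have "proper ?A"
    using Arr.prems(1,2) by (simp add: proper_bot_to_O proper_tsub proper_star)
  ultimately have "konst i (Lam c)" "typF \<Gamma> (Lam c) (Arr ?A (bot_to_O (tsub s (star B))))"
    by (simp_all add: konst.Lam typing.arr_i)
  then show ?case by auto
next
  case (Forall A)
  have "\<exists>c. konst i c \<and> typF (map (tren Suc) \<Gamma>) c (bot_to_O (tsub (tups s) (star A)))"
    by (rule Forall.IH) (use Forall.prems in \<open>auto intro: proper_tups\<close>)
  moreover have "0 \<in> ftv (bot_to_O (tsub (tups s) (star A)))"
    using Forall.prems(1) by (simp add: ftv_tups)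
  ultimately show ?case using typing.all_i by (simp del: ftv_bot_to_O) blast
qed (use konst_Arr_TO in \<open>simp_all add: neg_def proper_bot_to_O\<close>)

lemma beta_sub: "beta t u \<Longrightarrow> beta (sub \<sigma> t) (sub \<sigma> u)"
  by (induction arbitrary: \<sigma> rule: beta.induct) (simp_all add: beta.intros sub_sub_inst)

lemma betas_sub: "beta\<^sup>*\<^sup>* t u \<Longrightarrow> beta\<^sup>*\<^sup>* (sub \<sigma> t) (sub \<sigma> u)"
  by (induction rule: rtranclp_induct)
    (rule rtranclp.rtrancl_refl, erule rtranclp.rtrancl_into_rtrancl, erule beta_sub)

text \<open>An application of a constant function to arguments reduces to a constant function, so the
  outermost occurrences of the substituted variables leave a trace in the normal form.\<close>
lemma konst_sub_normal:
  "normal m \<Longrightarrow> (\<And>i. (\<exists>j. \<sigma> i = Var j) \<or> konst a (\<sigma> i)) \<Longrightarrow>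
    \<exists>m'. normal m' \<and> beta\<^sup>*\<^sup>* (sub \<sigma> m) m' \<and> ((\<exists>i\<in>fv m. konst a (\<sigma> i)) \<longrightarrow> a \<in> fv m') \<and>
      ((\<forall>s. m \<noteq> Lam s) \<longrightarrow> (\<forall>s. m' \<noteq> Lam s) \<or> konst a m')"
proof (induction m arbitrary: \<sigma> a)
  case (Var i)
  show ?case
  proof (cases "konst a (\<sigma> i)")
    case True
    with konst_normal[OF this] show ?thesis by (intro exI[of _ "\<sigma> i"]) simp
  next
    case False
    with Var.prems(2)[of i] show ?thesis by (intro exI[of _ "\<sigma> i"]) auto
  qed
next
  case (App s t)
  have s: "normal s" "\<forall>u. s \<noteq> Lam u" and t: "normal t" using App.prems(1) by simp_all
  obtain s' where s': "normal s'" "beta\<^sup>*\<^sup>* (sub \<sigma> s) s'" "(\<exists>i\<in>fv s. konst a (\<sigma> i)) \<longrightarrow> a \<in> fv s'"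
    "(\<forall>u. s' \<noteq> Lam u) \<or> konst a s'"
    using App.IH(1)[of \<sigma> a, OF s(1) App.prems(2)] s(2) by blast
  obtain t' where t': "normal t'" "beta\<^sup>*\<^sup>* (sub \<sigma> t) t'" "(\<exists>i\<in>fv t. konst a (\<sigma> i)) \<longrightarrow> a \<in> fv t'"
    using App.IH(2)[of \<sigma> a, OF t App.prems(2)] by blast
  have red: "beta\<^sup>*\<^sup>* (sub \<sigma> (App s t)) (App s' t')" using betas_app[OF s'(2) t'(2)] by simp
  show ?case
  proof (cases "\<exists>c. s' = Lam c")
    case True
    then obtain c where c: "s' = Lam c" "konst a (Lam c)" using s'(4) by blast
    \<comment> \<open>The argument is discarded and \<open>Suc a\<close> drops to \<open>a\<close>.
      Occurrences lost with the argument do no harm, because \<open>a\<close> remains free in the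
      result.\<close>
    from c(2) have "konst a (sub (inst t') c)" by (auto elim!: konst_LamE intro: konst_sub)
    moreover have "beta\<^sup>*\<^sup>* (sub \<sigma> (App s t)) (sub (inst t') c)"
      using red beta.redex[of c t'] unfolding c(1) by (rule rtranclp.rtrancl_into_rtrancl)
    ultimately show ?thesis using konst_normal by blast
  next
    case False
    with s' t' have "normal (App s' t')" "(\<exists>i\<in>fv (App s t). konst a (\<sigma> i)) \<longrightarrow> a \<in> fv (App s' t')"
      by auto
    with red show ?thesis by blast
  qed
next
  case (Lam t)
  have "(\<exists>j. ups \<sigma> i = Var j) \<or> konst (Suc a) (ups \<sigma> i)" for i
  proof (cases i)
    case (Suc k)
    with Lam.prems(2)[of k] konst_ren[of a "\<sigma> k" Suc] show ?thesis by auto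
  qed simp
  with Lam.IH[of "ups \<sigma>" "Suc a"] Lam.prems(1) obtain t' where t': "normal t'"
    "beta\<^sup>*\<^sup>* (sub (ups \<sigma>) t) t'" "(\<exists>i\<in>fv t. konst (Suc a) (ups \<sigma> i)) \<longrightarrow> Suc a \<in> fv t'"
    by auto
  have "a \<in> fv (Lam t')" if "i \<in> fv (Lam t)" "konst a (\<sigma> i)" for i
    using t'(3) that konst_ren[of a "\<sigma> i" Suc] by (auto intro: bexI[of _ "Suc i"])
  moreover have "beta\<^sup>*\<^sup>* (sub \<sigma> (Lam t)) (Lam t')" using betas_lam[OF t'(2)] by simp
  ultimately show ?case using t'(1) by (intro exI[of _ "Lam t'"]) auto
qed

lemma closures_value:
  assumes clo: "closures \<Gamma> cs" and D: "\<Gamma> ! 0 = neg D" "proper D" "output_type D" "\<not> has_Bot D"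
    and \<tau>: "typF \<Gamma> \<tau> D"
  obtains \<tau>' where "beta_eq \<tau> \<tau>'" "typF [] \<tau>' D"
proof -
  \<comment> \<open>Indices outside the context receive the default \<open>Var 0\<close>, so that
    \<open>konst 0 (\<sigma> k)\<close> holds for every \<open>k\<close>.\<close>
  have "\<exists>c. konst 0 c \<and> (k < length \<Gamma> \<longrightarrow> typF [TO] c (bot_to_O (\<Gamma> ! k)))" for k
  proof (cases "k < length \<Gamma>")
    case True
    show ?thesis
    proof (cases "k = 0")
      case True
      have "typF [TO] (Lam (Var 1)) (Arr (bot_to_O D) TO)"
        using typing.ax[of 1 "[bot_to_O D, TO]" True] D(2) by (simp add: typing.arr_i proper_bot_to_O)
      then show ?thesis using True D(1)
        by (intro exI[of _ "Lam (Var 1)"]) (auto simp: neg_def intro: konst.intros)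
    next
      case False
      with clo \<open>k < length \<Gamma>\<close> have "closure (take k \<Gamma>) (fst (cs ! k)) (snd (cs ! k)) (\<Gamma> ! k)"
        unfolding closures_def by blast
      then obtain \<Delta> A s where "typF0 \<Delta> (fst (cs ! k)) A" "\<forall>C\<in>set \<Delta>. proper C"
        and s: "\<And>n. proper (s n)" "\<Gamma> ! k = tsub s (star A)"
        unfolding closure_def by blast
      then have "proper A" using typing_proper by blast
      from konst_star[of A s 0 "[TO]", OF this s(1)] obtain c
        where "konst 0 c" "typF [TO] c (bot_to_O (tsub s (star A)))" by auto
      with s(2) show ?thesis by (intro exI[of _ c]) simp
    qed
  qed (auto intro: konst.Var)
  then obtain \<sigma> where \<sigma>: "\<And>k. konst 0 (\<sigma> k)"
    "\<And>k. k < length \<Gamma> \<Longrightarrow> typF [TO] (\<sigma> k) (bot_to_O (\<Gamma> ! k))" by metis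
  have "typF (map bot_to_O \<Gamma>) \<tau> D" using typing_bot_to_O[OF \<tau>] by (simp add: bot_to_O_id D(4))
  then have sub_\<tau>: "typF [TO] (sub \<sigma> \<tau>) D"
    by (rule typing_sub) (use \<sigma>(2) typing_fv[OF \<tau>] in simp)
  obtain m where m: "beta\<^sup>*\<^sup>* \<tau> m" "normal m" using typing_normalizes[OF \<tau>] by blast
  obtain n where n: "normal n" "beta\<^sup>*\<^sup>* (sub \<sigma> m) n" "(\<exists>i\<in>fv m. konst 0 (\<sigma> i)) \<longrightarrow> 0 \<in> fv n"
    using konst_sub_normal[OF m(2), of \<sigma> 0] \<sigma>(1) by blast
  from betas_sub[OF m(1), of \<sigma>] n(2) have "beta\<^sup>*\<^sup>* (sub \<sigma> \<tau>) n" by (rule rtranclp_trans)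
  then have "typF [TO] n D" using sub_\<tau> by (rule subject_reduction)
  with D(3) n(1) have "0 \<notin> fv n" by (simp add: output_type_def)
  \<comment> \<open>Any free variable of \<open>m\<close> is replaced by a constant function
    returning \<alpha>, so it would make \<alpha> free in \<open>n\<close>.\<close>
  with n(3) \<sigma>(1) have "fv m = {}" by blast
  moreover have "typF \<Gamma> m D" by (rule subject_reduction[OF m(1) \<tau>])
  ultimately have "typF [] (sub Var m) D" by (intro typing_sub) simp_all
  with betas_beta_eq[OF m(1)] show thesis by (intro that) simp_all
qed

text \<open>\<open>star\<close> commutes with arrows, quantifiers and shifts, so every rule of F0 is
  preserved; the excluded rule of instantiation would not be.\<close>

lemma typF0_star: "typing b \<Gamma> t A \<Longrightarrow> \<not> b \<Longrightarrow> \<forall>B\<in>set \<Gamma>. proper B \<Longrightarrow> typF (map star \<Gamma>) t (star A)"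
proof (induction rule: typing.induct)
  case (ax i \<Gamma> e)
  then show ?case using typing.ax[of i "map star \<Gamma>" True] by simp
next
  case (arr_i B e \<Gamma> t C)
  then show ?case by (simp add: typing.arr_i proper_star)
next
  case (arr_e e \<Gamma> u B C v)
  then show ?case by (auto intro: typing.arr_e)
next
  case (all_i e \<Gamma> t A)
  have "map star (map (tren Suc) \<Gamma>) = map (tren Suc) (map star \<Gamma>)" by (simp add: star_tren)
  moreover have "typF (map star (map (tren Suc) \<Gamma>)) t (star A)"
    using all_i.prems by (intro all_i.IH) (simp_all add: proper_tren)
  ultimately have "typF (map (tren Suc) (map star \<Gamma>)) t (star A)" by (simp only:)
  with all_i.hyps(2) show ?case by (simp add: typing.all_i)
qed simp

theorem theorem4p2:
  fixes D :: ty and T :: tm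
  assumes "syntactical_data_type D"
    and "\<not> has_Bot D"
    and "fv T = {}"
    and "typF [] T (Arr (star D) (neg (neg D)))"
  shows "\<forall>t. typF [] t D \<longrightarrow>
           (\<exists>\<tau> \<tau>'. beta_eq \<tau> \<tau>' \<and> typF [] \<tau>' D \<and>
              (\<forall>\<theta>. beta_eq \<theta> t \<longrightarrow>
                 (\<forall>f. f \<notin> fv \<theta> \<longrightarrow>
                    (\<exists>\<sigma>. whr (App (App T \<theta>) (Var f)) (App (Var f) (sub \<sigma> \<tau>))))))"
proof (intro allI impI)
  fix t assume t: "typF [] t D"
  have D: "output_type D" "proper D" "ftv D = {}" "normal t \<Longrightarrow> typF [] t D \<Longrightarrow> typF0 [] t D" for t
    using assms(1) by (auto simp: syntactical_data_type_def input_type_def output_type_def closed_ty_def)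
  obtain n where n: "beta\<^sup>*\<^sup>* t n" "normal n" using typing_normalizes[OF t] by blast
  have n0: "typF0 [] n D" by (rule D(4)[OF n(2) subject_reduction[OF n(1) t]])
  have n_star: "typF [] n (star D)" using typF0_star[OF n0] by simp
  \<comment> \<open>Variable 0 is f and variable 1 is the closure of \<open>n\<close> with empty
    environment; the first entry of \<open>cs\<close> merely aligns the indices.\<close>
  define \<Gamma> where "\<Gamma> = [neg D, star D]"
  define cs :: "(tm \<times> tm list) list" where "cs = [(Var 0, []), (n, [])]"
  define M where "M = App (App T (Var 1)) (Var 0)"
  have clo: "closure \<Gamma>' n [] (star D)" for \<Gamma>'
    unfolding closure_def using n0 by (intro exI[of _ "[]"] exI[of _ D] exI[of _ TV]) simp
  then have closures: "closures \<Gamma> cs" by (auto simp: closures_def \<Gamma>_def cs_def less_Suc_eq)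
  have T: "typF \<Gamma> T (Arr (star D) (neg (neg D)))" for \<Gamma> using typing_weaken[OF assms(4)] by simp
  have V: "typF \<Gamma> (Var 1) (star D)" "typF \<Gamma> (Var 0) (neg D)"
    using typing.ax[of 1 \<Gamma> True] typing.ax[of 0 \<Gamma> True] by (simp_all add: \<Gamma>_def)
  have M: "typF \<Gamma> M TBot"
    unfolding M_def using typing.arr_e[OF T V(1)] V(2) by (auto simp: neg_def intro: typing.arr_e)
  have realizes: "realizes (case_nat f (\<lambda>_. w)) cs" if "st w n" for f w
  proof -
    have "evals \<sigma> n [] w" for \<sigma> using that unfolding evals_def by (intro exI[of _ w] exI[of _ Var]) simp
    then show ?thesis by (auto simp: realizes_def cs_def less_Suc_eq)
  qed
  have sub_M: "sub (case_nat f (\<lambda>_. w)) M = App (App T w) f" for f w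
    by (simp add: M_def sub_closed[OF assms(3)])
  \<comment> \<open>The terminating realizer takes \<open>n\<close> itself as the argument and f as
    itself, so that the initial term is typable.\<close>
  have "typF \<Gamma> n (star D)" using typing_weaken[OF n_star] by simp
  from typing.arr_e[OF T this] V(2) have "typF \<Gamma> (App (App T n) (Var 0)) TBot"
    by (auto simp: neg_def intro: typing.arr_e)
  from typing_whr1_terminates[OF this]
  have "stores D \<Gamma> cs M"
    by (rule stores_terminating[where \<sigma> = "case_nat (Var 0) (\<lambda>_. n)"])
      (use closures M in \<open>simp_all add: sub_M realizes[OF st_refl]\<close>, simp_all add: \<Gamma>_def)
  then obtain \<Gamma>' cs' \<tau> where *: "closures (\<Gamma> @ \<Gamma>') (cs @ cs')" "typF (\<Gamma> @ \<Gamma>') \<tau> D"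
    and run: "\<And>\<sigma>. realizes \<sigma> cs \<Longrightarrow> \<exists>\<sigma>'. whr (sub \<sigma> M) (App (\<sigma> 0) (sub \<sigma>' \<tau>))"
    unfolding stores_def by blast
  have "(\<Gamma> @ \<Gamma>') ! 0 = neg D" by (simp add: \<Gamma>_def)
  then obtain \<tau>' where \<tau>': "beta_eq \<tau> \<tau>'" "typF [] \<tau>' D"
    using closures_value[OF *(1) _ D(2,1) assms(2) *(2)] by blast
  have "\<exists>\<sigma>. whr (App (App T \<theta>) (Var f)) (App (Var f) (sub \<sigma> \<tau>))" if "beta_eq \<theta> t" for \<theta> f
  proof -
    have "beta_eq \<theta> n"
      using that betas_beta_eq[OF n(1)] unfolding beta_eq_def by (rule equivclp_trans)
    \<comment> \<open>Standardization makes \<open>\<theta>\<close> a representative of the closure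
      of \<open>n\<close>, so the run already found applies to it with the same
      \<open>\<tau>\<close>.\<close>
    then have "st \<theta> n" using n(2) by (intro betas_st beta_eq_normal)
    from run[OF realizes[OF this, of "Var f"]] show ?thesis by (simp add: sub_M)
  qed
  with \<tau>' show "\<exists>\<tau> \<tau>'. beta_eq \<tau> \<tau>' \<and> typF [] \<tau>' D \<and> (\<forall>\<theta>. beta_eq \<theta> t \<longrightarrow>
      (\<forall>f. f \<notin> fv \<theta> \<longrightarrow> (\<exists>\<sigma>. whr (App (App T \<theta>) (Var f)) (App (Var f) (sub \<sigma> \<tau>)))))"
    by blast
qed

end
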